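(* Let $l>0$ and $\rho^2-\rho^1>0$. Let $k\ge3$ and let $f_0\in L^1(\mathbb R)\cap H^k_l(\mathbb R)$ with $f_0\ge0$, $f_0\not\equiv0$. Let $f(x,t)$ be the classical solution with $f(x,0)=f_0(x)$ of the confined Muskat equation $$\partial_t f(x,t)=\frac{\rho^2-\rho^1}{8l}\,\mathrm{P.V.}\int_{\mathbb R}\Big[\big(\partial_xf(x)-\partial_xf(x-\eta)\big)\Xi_1(x,\eta)+\big(\partial_xf(x)+\partial_xf(x-\eta)\big)\Xi_2(x,\eta)\Big]d\eta .$$ Then there is a constant $c=c(\|f_0\|_{L^1},\|f_0\|_{L^\infty},\rho^2,\rho^1,l)>0$, depending only on the indicated quantities, such that $$\frac{d}{dt}\|f(t)\|_{L^\infty}\le -c\,e^{-\frac{\pi\|f_0\|_{L^1}}{l\,\|f(t)\|_{L^\infty}}}$$ for almost every $t$ in the interval of existence.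
   Context: The strip is $\mathbb R\times(-l,l)$, $l>0$; $\rho^1,\rho^2$ are the constant densities of the upper and lower fluid, and the interface is the graph of $f(\cdot,t)$. Function space: $H^s_l(\mathbb R)=H^s(\mathbb R)\cap\{f:\|f\|_{L^\infty}<l\}$. Kernels (with time dependence suppressed): $$\Xi_1(x,\eta)=\frac{\sinh\left(\frac{\pi}{2l}\eta\right)}{\cosh\left(\frac{\pi}{2l}\eta\right)-\cos\left(\frac{\pi}{2l}(f(x)-f(x-\eta))\right)},\qquad \Xi_2(x,\eta)=\frac{\sinh\left(\frac{\pi}{2l}\eta\right)}{\cosh\left(\frac{\pi}{2l}\eta\right)+\cos\left(\frac{\pi}{2l}(f(x)+f(x-\eta))\right)}.$$ P.V. denotes principal value (at $\eta=0$ and at infinity). For $\rho^2-\rho^1>0$ and $f_0\in H^k_l(\mathbb R)$, $k\ge3$, the classical solution is the unique solution $f\in C([0,T],H^k_l(\mathbb R))\cap C^1([0,T],C(\mathbb R))\cap C([0,T],C^2(\mathbb R))$, which exists on some time interval $[0,T]$, $T>0$. The function $t\mapsto\|f(t)\|_{L^\infty}$ is understood as a Lipschitz function, differentiable almost everywhere. *)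

theory Defs
  imports "HOL-Analysis.Analysis" "HOL-Probability.Essential_Supremum"
begin

section \<open>Lebesgue norms\<close>

definition Linf_norm :: "(real \<Rightarrow> real) \<Rightarrow> ereal" where
  "Linf_norm f = esssup lborel (\<lambda>x. ereal \<bar>f x\<bar>)"

definition L1_norm :: "(real \<Rightarrow> real) \<Rightarrow> real" where
  "L1_norm f = (LINT x|lborel. \<bar>f x\<bar>)"

definition L2_space :: "(real \<Rightarrow> real) set" where
  "L2_space = {f \<in> borel_measurable lborel. integrable lborel (\<lambda>x. (f x)\<^sup>2)}"


section \<open>The Sobolev spaces of integer order on the line\<close>

definition test_function :: "(real \<Rightarrow> real) \<Rightarrow> bool" where
  "test_function \<phi> \<longleftrightarrow>
     (\<forall>n x. (deriv ^^ n) \<phi> differentiable (at x)) \<and> bounded {x. \<phi> x \<noteq> 0}"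

definition has_weak_deriv :: "nat \<Rightarrow> (real \<Rightarrow> real) \<Rightarrow> (real \<Rightarrow> real) \<Rightarrow> bool" where
  "has_weak_deriv j f g \<longleftrightarrow>
     (\<forall>\<phi>. test_function \<phi> \<longrightarrow>
        (LINT x|lborel. f x * (deriv ^^ j) \<phi> x) = (-1) ^ j * (LINT x|lborel. g x * \<phi> x))"

definition sobolev_space :: "nat \<Rightarrow> (real \<Rightarrow> real) set" where
  "sobolev_space k = {f \<in> L2_space. \<forall>j\<le>k. \<exists>g\<in>L2_space. has_weak_deriv j f g}"

text \<open>Weak derivatives are unique only almost everywhere; the Sobolev norm does not depend on the
  representative that is selected.\<close>

definition weak_deriv :: "nat \<Rightarrow> (real \<Rightarrow> real) \<Rightarrow> real \<Rightarrow> real" where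
  "weak_deriv j f = (SOME g. g \<in> L2_space \<and> has_weak_deriv j f g)"

definition sobolev_norm :: "nat \<Rightarrow> (real \<Rightarrow> real) \<Rightarrow> real" where
  "sobolev_norm k f = sqrt (\<Sum>j\<le>k. LINT x|lborel. (weak_deriv j f x)\<^sup>2)"

definition sobolev_space_strip :: "real \<Rightarrow> nat \<Rightarrow> (real \<Rightarrow> real) set" where
  "sobolev_space_strip l k = {f \<in> sobolev_space k. Linf_norm f < ereal l}"


section \<open>Regularity classes of curves of functions\<close>

text \<open>The spatial profile at time \<open>t\<close> is \<open>f t\<close>. At the endpoints of \<open>[0,T]\<close> all limits and
  derivatives in time are one-sided. The spaces \<open>C(\<real>)\<close> and \<open>C\<^sup>2(\<real>)\<close> carry their uniform norms, so
  that \<open>C(\<real>)\<close> is the library type of bounded continuous functions.\<close>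

definition cont_into_sobolev_strip ::
    "real \<Rightarrow> nat \<Rightarrow> real \<Rightarrow> (real \<Rightarrow> real \<Rightarrow> real) \<Rightarrow> bool" where
  "cont_into_sobolev_strip l k T f \<longleftrightarrow>
     (\<forall>t\<in>{0..T}. f t \<in> sobolev_space_strip l k) \<and>
     (\<forall>t\<in>{0..T}. ((\<lambda>s. sobolev_norm k (\<lambda>x. f s x - f t x)) \<longlongrightarrow> 0) (at t within {0..T}))"

definition C1_into_C :: "real \<Rightarrow> (real \<Rightarrow> real \<Rightarrow> real) \<Rightarrow> bool" where
  "C1_into_C T f \<longleftrightarrow>
     (\<forall>t\<in>{0..T}. f t \<in> bcontfun) \<and>
     (\<exists>v :: real \<Rightarrow> real \<Rightarrow>\<^sub>C real. continuous_on {0..T} v \<and>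
        (\<forall>t\<in>{0..T}. ((\<lambda>s. Bcontfun (f s)) has_vector_derivative v t) (at t within {0..T})))"

definition cont_into_C2 :: "real \<Rightarrow> (real \<Rightarrow> real \<Rightarrow> real) \<Rightarrow> bool" where
  "cont_into_C2 T f \<longleftrightarrow>
     (\<forall>t\<in>{0..T}. \<forall>j<2. \<forall>x. (deriv ^^ j) (f t) differentiable (at x)) \<and>
     (\<forall>j\<le>2. (\<forall>t\<in>{0..T}. (deriv ^^ j) (f t) \<in> bcontfun) \<and>
             continuous_on {0..T} (\<lambda>t. Bcontfun ((deriv ^^ j) (f t))))"


section \<open>The confined Muskat equation\<close>

text \<open>The truncation at the origin and the one at infinity are removed independently.\<close>

definition has_pv_integral :: "(real \<Rightarrow> real) \<Rightarrow> real \<Rightarrow> bool" where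
  "has_pv_integral g I \<longleftrightarrow>
     (\<forall>\<epsilon>>0. \<forall>R. set_integrable lborel {\<eta>. \<epsilon> \<le> \<bar>\<eta>\<bar> \<and> \<bar>\<eta>\<bar> \<le> R} g) \<and>
     ((\<lambda>(\<epsilon>, R). LINT \<eta>:{\<eta>. \<epsilon> \<le> \<bar>\<eta>\<bar> \<and> \<bar>\<eta>\<bar> \<le> R}|lborel. g \<eta>) \<longlongrightarrow> I)
       (at_right 0 \<times>\<^sub>F at_top)"

definition Xi1 :: "real \<Rightarrow> (real \<Rightarrow> real) \<Rightarrow> real \<Rightarrow> real \<Rightarrow> real" where
  "Xi1 l h x \<eta> = sinh (pi / (2 * l) * \<eta>) /
     (cosh (pi / (2 * l) * \<eta>) - cos (pi / (2 * l) * (h x - h (x - \<eta>))))"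

definition Xi2 :: "real \<Rightarrow> (real \<Rightarrow> real) \<Rightarrow> real \<Rightarrow> real \<Rightarrow> real" where
  "Xi2 l h x \<eta> = sinh (pi / (2 * l) * \<eta>) /
     (cosh (pi / (2 * l) * \<eta>) + cos (pi / (2 * l) * (h x + h (x - \<eta>))))"

definition muskat_integrand :: "real \<Rightarrow> (real \<Rightarrow> real) \<Rightarrow> real \<Rightarrow> real \<Rightarrow> real" where
  "muskat_integrand l h x \<eta> =
     (deriv h x - deriv h (x - \<eta>)) * Xi1 l h x \<eta> +
     (deriv h x + deriv h (x - \<eta>)) * Xi2 l h x \<eta>"

text \<open>The arguments \<open>\<rho>1\<close> and \<open>\<rho>2\<close> are the densities of the upper and of the lower fluid.\<close>

definition muskat_equation ::
    "real \<Rightarrow> real \<Rightarrow> real \<Rightarrow> real \<Rightarrow> (real \<Rightarrow> real \<Rightarrow> real) \<Rightarrow> bool" where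
  "muskat_equation l \<rho>1 \<rho>2 T f \<longleftrightarrow>
     (\<forall>t\<in>{0..T}. \<forall>x. \<exists>I. has_pv_integral (muskat_integrand l (f t) x) I \<and>
        ((\<lambda>s. f s x) has_real_derivative (\<rho>2 - \<rho>1) / (8 * l) * I) (at t within {0..T}))"

definition classical_solution ::
    "real \<Rightarrow> real \<Rightarrow> real \<Rightarrow> nat \<Rightarrow> real \<Rightarrow> (real \<Rightarrow> real) \<Rightarrow> (real \<Rightarrow> real \<Rightarrow> real) \<Rightarrow> bool" where
  "classical_solution l \<rho>1 \<rho>2 k T f0 f \<longleftrightarrow>
     cont_into_sobolev_strip l k T f \<and> C1_into_C T f \<and> cont_into_C2 T f \<and>
     muskat_equation l \<rho>1 \<rho>2 T f \<and> f 0 = f0"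

end

theory Submission
  imports Defs
begin

text \<open>
  Write \<open>K = \<pi> / (2 l)\<close>. The argument follows the highest point of the interface.

  At a point \<open>x\<close> where a profile \<open>h\<close> is maximal, \<open>h'(x) = 0\<close>, and the derivative
  \<open>h'(x - \<eta>)\<close> can be removed from the singular integral: each of the two kernels times this derivative
  equals an exact derivative in \<open>\<eta>\<close> of an arctangent, up to an elementary kernel free of derivatives
  (\<open>has_derivative_arctan_tan_over_tanh\<close>, \<open>has_derivative_arctan_tan_times_tanh\<close>). Subtracting the same
  expression for the constant profile \<open>h(x)\<close> makes the boundary terms vanish at the origin and at
  infinity. What remains is minus the integral of \<open>drift\<close>, and half-angle formulas factor \<open>drift\<close> into
  factors that are nonnegative as long as the interface stays inside the strip (\<open>drift_eq\<close>,
  \<open>drift_nonneg\<close>). So a maximum cannot move up (\<open>pv_integral_at_maximum\<close>). The equation is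
  odd in the unknown, so a minimum cannot move down; hence the solution stays nonnegative
  and below its initial height (\<open>stays_nonneg\<close>, \<open>height_bound\<close>).

  The same arctangents, differentiated in \<open>x\<close> instead of \<open>\<eta>\<close>, give back the integrand of the equation.
  The equation is thus a conservation law. Its flux vanishes at spatial infinity uniformly in time, so
  the mass \<open>A\<close> of the solution is conserved (\<open>mass_nearly_constant\<close>), and the solution never becomes
  flat (\<open>never_flat\<close>).

  Conservation of mass makes the maximum principle quantitative (\<open>crest_sinks\<close>). Let \<open>M\<close> be the maximal
  height. In the window \<open>1 \<le> \<bar>\<eta>\<bar> \<le> R\<close> with \<open>R = 3/2 + A / (2 M)\<close> the solution cannot fill the level
  \<open>M\<close>: the integral of \<open>M - f\<close> over the window is at least \<open>M\<close>. On the window \<open>drift\<close> is at least a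
  constant times \<open>(M - f) e\<^sup>-\<^sup>K\<^sup>R\<close> (\<open>drift_lower_bound\<close>), so the crest sinks at a speed of at least a constant
  times \<open>M exp (- K A / (2 M))\<close>. The inequality \<open>K A \<le> M exp (K A / M)\<close> trades the factor \<open>M\<close> for a
  larger exponent, and the exponent \<open>2 K A / M = \<pi> A / (l M)\<close> leaves room for this trade.

  It remains to differentiate the height itself. If all points of maximal height have the same
  vertical velocity at time \<open>t\<close>, the height is differentiable at \<open>t\<close> with this derivative
  (\<open>top_value_has_derivative\<close>). If two such points have different velocities and \<open>q\<close> is a rational
  number between them, then \<open>t\<close> is a strict local minimum of the height minus \<open>q t\<close>. A real function has
  only countably many strict local minima, so the exceptional times form a countable set
  (\<open>countable_crest_branching\<close>).
\<close>

section \<open>The uniform norm and decay at infinity\<close>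

text \<open>If a continuous function exceeded its essential supremum at one point, it would do so on a nonempty
  open set, and such a set has positive measure.\<close>

lemma Linf_norm_eq_SUP:
  fixes h :: "real \<Rightarrow> real"
  assumes "continuous_on UNIV h"
  shows "Linf_norm h = (SUP x. ereal \<bar>h x\<bar>)"
proof (rule antisym)
  have [measurable]: "h \<in> borel_measurable borel"
    using assms by (rule borel_measurable_continuous_onI)
  show "Linf_norm h \<le> (SUP x. ereal \<bar>h x\<bar>)"
    unfolding Linf_norm_def by (rule esssup_I) (auto intro!: AE_I2 SUP_upper)
  show "(SUP x. ereal \<bar>h x\<bar>) \<le> Linf_norm h"
  proof (rule SUP_least, rule ccontr)
    fix x assume "\<not> ereal \<bar>h x\<bar> \<le> Linf_norm h"
    then obtain c where c: "Linf_norm h < ereal c" "ereal c < ereal \<bar>h x\<bar>"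
      using ereal_dense2[of "Linf_norm h" "ereal \<bar>h x\<bar>"] by (auto simp: not_le)
    define U where "U = {y. c < \<bar>h y\<bar>}"
    have "open U"
      unfolding U_def using assms by (intro open_Collect_less continuous_intros) auto
    moreover have "x \<in> U"
      using c by (simp add: U_def)
    ultimately have "emeasure lborel U \<noteq> 0"
      using open_not_negligible[of U] negligible_iff_null_sets[of U] null_sets_completionI[of U lborel]
      by (auto simp: null_sets_def)
    moreover have "AE y in lborel. ereal \<bar>h y\<bar> \<le> Linf_norm h"
      unfolding Linf_norm_def by (rule esssup_AE)
    then have "AE y in lborel. y \<notin> U"
    proof eventually_elim
      case (elim y)
      then have "ereal \<bar>h y\<bar> < ereal c"
        using c by (meson le_less_trans)
      then show ?case by (simp add: U_def)
    qed
    then have "emeasure lborel U = 0"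
      using \<open>open U\<close> by (subst (asm) AE_iff_measurable[of U]) auto
    ultimately show False by simp
  qed
qed

text \<open>A value of size \<open>e\<close> at \<open>x\<close> keeps the function above \<open>e / 2\<close> on an interval around \<open>x\<close> whose length
  depends only on \<open>e\<close> and the Lipschitz constant. Such an interval contributes a fixed amount to the
  integral of the square, which its tails cannot supply.\<close>

lemma square_integrable_Lipschitz_tendsto_0:
  fixes h :: "real \<Rightarrow> real"
  assumes h: "h \<in> L2_space" and L: "0 \<le> L" "\<And>x y. \<bar>h x - h y\<bar> \<le> L * \<bar>x - y\<bar>"
  shows "(h \<longlongrightarrow> 0) at_infinity"
proof (rule tendstoI)
  fix e :: real assume e: "0 < e"
  have [measurable]: "h \<in> borel_measurable borel" and int: "integrable lborel (\<lambda>x. (h x)\<^sup>2)"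
    using h by (auto simp: L2_space_def)
  \<comment> \<open>The summand 1 covers the case \<open>L = 0\<close>.\<close>
  define d where "d = e / (2 * (L + 1))"
  have d: "0 < d" and Ld: "L * d \<le> e / 2"
    using e L by (auto simp: d_def field_simps)
  have "(\<lambda>n. LINT y|lborel. indicator {y. real n \<le> \<bar>y\<bar>} y * (h y)\<^sup>2) \<longlonglongrightarrow> (LINT y|(lborel::real measure). 0)"
  proof (rule integral_dominated_convergence[where w = "\<lambda>x. (h x)\<^sup>2"])
    show "AE y in lborel. (\<lambda>n. indicator {y. real n \<le> \<bar>y\<bar>} y * (h y)\<^sup>2) \<longlonglongrightarrow> 0"
    proof (rule AE_I2, rule tendsto_eventually)
      fix y :: real
      obtain N where "\<bar>y\<bar> < real N" using reals_Archimedean2 by blast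
      then show "\<forall>\<^sub>F n in sequentially. indicator {y. real n \<le> \<bar>y\<bar>} y * (h y)\<^sup>2 = 0"
        by (intro eventually_sequentiallyI[of N]) (auto simp: indicator_def)
    qed
  qed (use int in \<open>auto simp: indicator_def\<close>)
  then have lim: "(\<lambda>n. LINT y|lborel. indicator {y. real n \<le> \<bar>y\<bar>} y * (h y)\<^sup>2) \<longlonglongrightarrow> 0" by simp
  have pos: "0 < (e / 2)\<^sup>2 * (2 * d)" using e d by simp
  obtain N where N: "(LINT y|lborel. indicator {y. real N \<le> \<bar>y\<bar>} y * (h y)\<^sup>2) < (e / 2)\<^sup>2 * (2 * d)"
    using order_tendstoD(2)[OF lim pos] by (auto simp: eventually_sequentially)
  show "\<forall>\<^sub>F x in at_infinity. dist (h x) 0 < e"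
    unfolding eventually_at_infinity
  proof (intro exI[of _ "real N + d"] allI impI)
    fix x :: real assume x: "real N + d \<le> norm x"
    show "dist (h x) 0 < e"
    proof (rule ccontr)
      assume "\<not> dist (h x) 0 < e"
      then have hx: "e \<le> \<bar>h x\<bar>" by simp
      have "(LINT y|lborel. (e / 2)\<^sup>2 * indicator {x - d..x + d} y) \<le>
          (LINT y|lborel. indicator {y. real N \<le> \<bar>y\<bar>} y * (h y)\<^sup>2)"
      proof (rule integral_mono)
        show "integrable lborel (\<lambda>y. indicator {y. real N \<le> \<bar>y\<bar>} y * (h y)\<^sup>2)"
          by (rule Bochner_Integration.integrable_bound[OF int]) (auto simp: indicator_def)
        fix y
        show "(e / 2)\<^sup>2 * indicator {x - d..x + d} y \<le> indicator {y. real N \<le> \<bar>y\<bar>} y * (h y)\<^sup>2"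
        proof (cases "y \<in> {x - d..x + d}")
          case True
          then have "\<bar>x - y\<bar> \<le> d" by auto
          then have "L * \<bar>x - y\<bar> \<le> e / 2" using Ld L(1) mult_left_mono by fastforce
          then have "e / 2 \<le> \<bar>h y\<bar>" using L(2)[of x y] hx by linarith
          then have "(e / 2)\<^sup>2 \<le> (h y)\<^sup>2" using e by (metis abs_le_square_iff abs_of_pos half_gt_zero)
          moreover have "real N \<le> \<bar>y\<bar>" using x \<open>\<bar>x - y\<bar> \<le> d\<close> by simp
          ultimately show ?thesis by (simp add: indicator_def)
        qed auto
      qed (auto intro!: integrable_mult_right integrable_real_indicator simp: emeasure_lborel_Icc_eq)
      then show False using N d by (simp add: integral_indicator)
    qed
  qed
qed

section \<open>Arctangent primitives of the two kernels\<close>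

lemma tan_over_tanh_square_sum:
  fixes a b :: real
  shows "(cos b * sinh a)\<^sup>2 + (sin b * cosh a)\<^sup>2 = (cosh (2 * a) - cos (2 * b)) / 2"
proof -
  have "(sin b)\<^sup>2 + (cos b)\<^sup>2 = 1" "(cosh a)\<^sup>2 = 1 + (sinh a)\<^sup>2"
    by (simp_all add: cosh_square_eq)
  then have "2 * ((cos b * sinh a)\<^sup>2 + (sin b * cosh a)\<^sup>2) = cosh (2 * a) - cos (2 * b)"
    unfolding cosh_double cos_double by algebra
  then show ?thesis by simp
qed

lemma tan_times_tanh_square_sum:
  fixes a b :: real
  shows "(cos b * cosh a)\<^sup>2 + (sin b * sinh a)\<^sup>2 = (cosh (2 * a) + cos (2 * b)) / 2"
proof -
  have "(sin b)\<^sup>2 + (cos b)\<^sup>2 = 1" "(cosh a)\<^sup>2 = 1 + (sinh a)\<^sup>2"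
    by (simp_all add: cosh_square_eq)
  then have "2 * ((cos b * cosh a)\<^sup>2 + (sin b * sinh a)\<^sup>2) = cosh (2 * a) + cos (2 * b)"
    unfolding cosh_double cos_double by algebra
  then show ?thesis by simp
qed

lemma cos_pos_of_abs: "\<bar>y\<bar> < pi / 2 \<Longrightarrow> 0 < cos y" for y :: real
  by (intro cos_gt_zero_pi) linarith+

lemma arctan_tan_of_abs: "\<bar>y\<bar> < pi / 2 \<Longrightarrow> arctan (tan y) = y" for y :: real
  by (intro arctan_tan) linarith+

lemma cosh_gt_1: "1 < cosh y" if "y \<noteq> 0" for y :: real
  using that cosh_real_strict_mono[of 0 "\<bar>y\<bar>"] by (simp add: cosh_real_abs)

text \<open>With \<open>a = K \<eta> / 2\<close> and \<open>b = K (h x - h (x - \<eta>)) / 2\<close> the denominator on the right is that of the kernel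
  \<open>Xi1\<close>. If \<open>y\<close> is the position, only \<open>b\<close> varies and the derivative is a multiple of the first term of
  the integrand; if \<open>y\<close> is the offset \<open>\<eta>\<close>, the term with \<open>a'\<close> is the elementary kernel that replaces it.\<close>

lemma has_derivative_arctan_tan_over_tanh:
  fixes a b :: "real \<Rightarrow> real"
  assumes a: "(a has_real_derivative a') (at y)" and b: "(b has_real_derivative b') (at y)"
    and a0: "a y \<noteq> 0" and b0: "\<bar>b y\<bar> < pi / 2"
  shows "((\<lambda>y. arctan (tan (b y) / tanh (a y))) has_real_derivative
      (b' * sinh (2 * a y) - a' * sin (2 * b y)) / (cosh (2 * a y) - cos (2 * b y))) (at y)"
proof -
  define s c S C where "s = sin (b y)" and "c = cos (b y)" and "S = sinh (a y)" and "C = cosh (a y)"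
  have c: "0 < c" using b0 by (auto simp: c_def intro: cos_gt_zero_pi)
  have S: "S \<noteq> 0" using a0 by (simp add: S_def)
  have eq: "(\<lambda>y. arctan (tan (b y) / tanh (a y))) =
      (\<lambda>y. arctan (sin (b y) * cosh (a y) / (cos (b y) * sinh (a y))))"
    by (simp add: tan_def tanh_def)
  have nz: "cos (b y) * sinh (a y) \<noteq> 0" using c S by (simp add: c_def S_def)
  have sc: "s\<^sup>2 + c\<^sup>2 = 1" "C\<^sup>2 - S\<^sup>2 = 1"
    by (simp_all add: s_def c_def S_def C_def cosh_square_eq)
  define D where "D = (c * S)\<^sup>2 + (s * C)\<^sup>2"
  have D: "D > 0" using c S by (auto simp: D_def intro: add_pos_nonneg)
  have 1: "((\<lambda>y. arctan (tan (b y) / tanh (a y))) has_real_derivative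
     inverse (1 + (s * C / (c * S))\<^sup>2) *
     (((b' * c * C + s * (a' * S)) * (c * S) - s * C * (- (b' * s) * S + c * (a' * C))) / ((c * S) * (c * S)))) (at y)"
    unfolding eq s_def c_def S_def C_def using nz
    by (auto intro!: derivative_eq_intros a b simp: algebra_simps)
  have "(b' * c * C + s * (a' * S)) * (c * S) - s * C * (- (b' * s) * S + c * (a' * C))
      = b' * C * S * (s\<^sup>2 + c\<^sup>2) - a' * s * c * (C\<^sup>2 - S\<^sup>2)" by algebra
  also have "\<dots> = b' * C * S - a' * s * c" by (simp add: sc)
  finally have num: "(b' * c * C + s * (a' * S)) * (c * S) - s * C * (- (b' * s) * S + c * (a' * C))
      = b' * C * S - a' * s * c" .
  have "1 + (s * C / (c * S))\<^sup>2 = D / ((c * S) * (c * S))"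
    using c S by (simp add: D_def field_simps power2_eq_square)
  then have "inverse (1 + (s * C / (c * S))\<^sup>2) * ((b' * C * S - a' * s * c) / ((c * S) * (c * S)))
      = (b' * C * S - a' * s * c) / D"
    using c S D by (simp add: field_simps)
  also have "\<dots> = (b' * sinh (2 * a y) - a' * sin (2 * b y)) / (cosh (2 * a y) - cos (2 * b y))"
  proof -
    have "cosh (2 * a y) - cos (2 * b y) = 2 * D"
      using tan_over_tanh_square_sum[of "b y" "a y"] by (simp add: D_def s_def c_def S_def C_def)
    moreover have "b' * sinh (2 * a y) - a' * sin (2 * b y) = 2 * (b' * C * S - a' * s * c)"
      by (simp only: sinh_double sin_double s_def c_def S_def C_def) (simp add: algebra_simps)
    ultimately show ?thesis by (simp only: mult_divide_mult_cancel_left_if) simp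
  qed
  finally have fin: "inverse (1 + (s * C / (c * S))\<^sup>2) * ((b' * C * S - a' * s * c) / ((c * S) * (c * S)))
      = (b' * sinh (2 * a y) - a' * sin (2 * b y)) / (cosh (2 * a y) - cos (2 * b y))" .
  show ?thesis using 1 unfolding num fin .
qed

text \<open>The companion for the kernel \<open>Xi2\<close>, with \<open>b = K (h x + h (x - \<eta>)) / 2\<close>. Taking \<open>b\<close> constant also covers
  the profile that equals \<open>h x\<close> everywhere.\<close>

lemma has_derivative_arctan_tan_times_tanh:
  fixes a b :: "real \<Rightarrow> real"
  assumes a: "(a has_real_derivative a') (at y)" and b: "(b has_real_derivative b') (at y)"
    and b0: "\<bar>b y\<bar> < pi / 2"
  shows "((\<lambda>y. arctan (tan (b y) * tanh (a y))) has_real_derivative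
      (b' * sinh (2 * a y) + a' * sin (2 * b y)) / (cosh (2 * a y) + cos (2 * b y))) (at y)"
proof -
  define s c S C where "s = sin (b y)" and "c = cos (b y)" and "S = sinh (a y)" and "C = cosh (a y)"
  have c: "0 < c" using b0 by (auto simp: c_def intro: cos_gt_zero_pi)
  have C: "C > 0" by (simp add: C_def)
  have eq: "(\<lambda>y. arctan (tan (b y) * tanh (a y))) =
      (\<lambda>y. arctan (sin (b y) * sinh (a y) / (cos (b y) * cosh (a y))))"
    by (simp add: tan_def tanh_def)
  have nz: "cos (b y) * cosh (a y) \<noteq> 0" using c C by (simp add: c_def C_def)
  have sc: "s\<^sup>2 + c\<^sup>2 = 1" "C\<^sup>2 - S\<^sup>2 = 1"
    by (simp_all add: s_def c_def S_def C_def cosh_square_eq)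
  define D where "D = (c * C)\<^sup>2 + (s * S)\<^sup>2"
  have D: "D > 0" using c C by (auto simp: D_def intro: add_pos_nonneg)
  have 1: "((\<lambda>y. arctan (tan (b y) * tanh (a y))) has_real_derivative
     inverse (1 + (s * S / (c * C))\<^sup>2) *
     (((b' * c * S + s * (a' * C)) * (c * C) - s * S * (- (b' * s) * C + c * (a' * S))) / ((c * C) * (c * C)))) (at y)"
    unfolding eq s_def c_def S_def C_def using nz
    by (auto intro!: derivative_eq_intros a b simp: algebra_simps)
  have "(b' * c * S + s * (a' * C)) * (c * C) - s * S * (- (b' * s) * C + c * (a' * S))
      = b' * C * S * (s\<^sup>2 + c\<^sup>2) + a' * s * c * (C\<^sup>2 - S\<^sup>2)" by algebra
  also have "\<dots> = b' * C * S + a' * s * c" by (simp add: sc)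
  finally have num: "(b' * c * S + s * (a' * C)) * (c * C) - s * S * (- (b' * s) * C + c * (a' * S))
      = b' * C * S + a' * s * c" .
  have "1 + (s * S / (c * C))\<^sup>2 = D / ((c * C) * (c * C))"
    using c C by (simp add: D_def field_simps power2_eq_square)
  then have "inverse (1 + (s * S / (c * C))\<^sup>2) * ((b' * C * S + a' * s * c) / ((c * C) * (c * C)))
      = (b' * C * S + a' * s * c) / D"
    using c C D by (simp add: field_simps)
  also have "\<dots> = (b' * sinh (2 * a y) + a' * sin (2 * b y)) / (cosh (2 * a y) + cos (2 * b y))"
  proof -
    have "cosh (2 * a y) + cos (2 * b y) = 2 * D"
      using tan_times_tanh_square_sum[of "b y" "a y"] by (simp add: D_def s_def c_def S_def C_def)
    moreover have "b' * sinh (2 * a y) + a' * sin (2 * b y) = 2 * (b' * C * S + a' * s * c)"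
      by (simp only: sinh_double sin_double s_def c_def S_def C_def) (simp add: algebra_simps)
    ultimately show ?thesis by (simp only: mult_divide_mult_cancel_left_if) simp
  qed
  finally have fin: "inverse (1 + (s * S / (c * C))\<^sup>2) * ((b' * C * S + a' * s * c) / ((c * C) * (c * C)))
      = (b' * sinh (2 * a y) + a' * sin (2 * b y)) / (cosh (2 * a y) + cos (2 * b y))" .
  show ?thesis using 1 unfolding num fin .
qed

section \<open>The kernel that pulls a maximum down\<close>

text \<open>Here \<open>C = cosh (K \<eta>)\<close>, \<open>F = K h(x)\<close> and \<open>\<beta> = K (h(x) - h(x - \<eta>))\<close>. The first two terms are what
  the kernels \<open>Xi1\<close> and \<open>Xi2\<close> leave behind once the derivative has been integrated away at a maximum
  \<open>x\<close>; the last term is the contribution of the constant profile \<open>h(x)\<close>, so that the sum vanishes for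
  \<open>\<beta> = 0\<close>.\<close>

definition drift :: "real \<Rightarrow> real \<Rightarrow> real \<Rightarrow> real" where
  "drift C F \<beta> = sin \<beta> / (C - cos \<beta>) - sin (2 * F - \<beta>) / (C + cos (2 * F - \<beta>))
     + sin (2 * F) / (C + cos (2 * F))"

text \<open>Over the common denominator, the identity is polynomial in the sines and cosines of \<open>\<beta> / 2\<close> and
  \<open>F - \<beta> / 2\<close>, of which all angles that occur are integer combinations. Every sign can be read off the
  right-hand side.\<close>

lemma drift_eq:
  assumes "C - cos \<beta> \<noteq> 0" "C + cos (2 * F - \<beta>) \<noteq> 0" "C + cos (2 * F) \<noteq> 0"
  shows "drift C F \<beta> = 4 * cos F * cos (F - \<beta> / 2) * sin (\<beta> / 2)
      * (C\<^sup>2 + C - 2 * sin F * sin (F - \<beta> / 2) * cos (\<beta> / 2))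
    / ((C + cos (2 * F - \<beta>)) * (C - cos \<beta>) * (C + cos (2 * F)))"
proof -
  define p where "p = \<beta> / 2"
  define q where "q = F - p"
  have eqs: "\<beta> = 2 * p" "F = p + q" "2 * F - \<beta> = 2 * q" by (auto simp: p_def q_def)
  define s c s' c' where "s = sin p" and "c = cos p" and "s' = sin q" and "c' = cos q"
  have sc: "s\<^sup>2 + c\<^sup>2 = 1" "s'\<^sup>2 + c'\<^sup>2 = 1" by (simp_all add: s_def c_def s'_def c'_def)
  define b1 b2 b3 where "b1 = cos \<beta>" and "b2 = cos (2 * F - \<beta>)" and "b3 = cos (2 * F)"
  define sF cF where "sF = sin F" and "cF = cos F"
  have F: "sF = s * c' + c * s'" "cF = c * c' - s * s'"
    by (simp_all add: sF_def cF_def eqs sin_add cos_add s_def c_def s'_def c'_def)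
  have b: "b1 = c\<^sup>2 - s\<^sup>2" "b2 = c'\<^sup>2 - s'\<^sup>2" "b3 = cF\<^sup>2 - sF\<^sup>2"
    unfolding b1_def b2_def b3_def eqs(3) c_def s_def c'_def s'_def sF_def cF_def
    by (simp_all only: cos_double) (simp add: eqs(1) cos_double)
  have sn: "sin \<beta> = 2 * s * c" "sin (2 * F - \<beta>) = 2 * s' * c'" "sin (2 * F) = 2 * sF * cF"
    unfolding eqs(3) c_def s_def c'_def s'_def sF_def cF_def
    by (simp_all only: sin_double) (simp add: eqs(1) sin_double)
  have nz: "C - b1 \<noteq> 0" "C + b2 \<noteq> 0" "C + b3 \<noteq> 0" using assms by (auto simp: b1_def b2_def b3_def)
  have "2 * s * c * (C + b2) * (C + b3) - 2 * s' * c' * (C - b1) * (C + b3) + 2 * sF * cF * (C - b1) * (C + b2)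
    = 4 * cF * c' * s * (C\<^sup>2 + C - 2 * sF * s' * c)"
    using sc unfolding b F by algebra
  moreover have "u / (C - b1) - v / (C + b2) + w / (C + b3)
      = (u * (C + b2) * (C + b3) - v * (C - b1) * (C + b3) + w * (C - b1) * (C + b2))
        / ((C + b2) * (C - b1) * (C + b3))" for u v w
    using nz by (simp add: divide_simps) (simp add: algebra_simps)
  ultimately show ?thesis
    unfolding drift_def sn b1_def[symmetric] b2_def[symmetric] b3_def[symmetric]
      q_def[symmetric] p_def[symmetric] sF_def[symmetric] cF_def[symmetric]
      s_def[symmetric] c_def[symmetric] s'_def[symmetric] c'_def[symmetric]
    by simp
qed

text \<open>The bracket is nonnegative because \<open>C\<^sup>2 + C \<ge> 2\<close>. The condition on \<open>F - \<beta> / 2\<close>, which at an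
  interface is \<open>K (h(x) + h(x - \<eta>)) / 2\<close>, holds inside the strip even if \<open>h(x - \<eta>)\<close> is negative; this
  is what makes the maximum principle independent of the sign of the solution.\<close>

lemma drift_nonneg:
  assumes C: "1 < C" and F: "\<bar>F\<bar> < pi / 2" "\<bar>F - \<beta> / 2\<bar> < pi / 2" and \<beta>: "0 \<le> \<beta> / 2" "\<beta> / 2 \<le> pi"
  shows "0 \<le> drift C F \<beta>"
proof -
  have den: "0 < C - cos y" "0 < C + cos y" for y
    using C cos_le_one[of y] cos_ge_minus_one[of y] by linarith+
  have cF: "0 < cos F" and cq: "0 < cos (F - \<beta> / 2)" by (rule cos_pos_of_abs[OF F(1)], rule cos_pos_of_abs[OF F(2)])
  have s: "0 \<le> sin (\<beta> / 2)" by (rule sin_ge_zero[OF \<beta>])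
  have "1 \<le> C\<^sup>2" using C by (simp add: one_le_power)
  have "\<bar>sin F * sin (F - \<beta> / 2) * cos (\<beta> / 2)\<bar> \<le> 1 * 1 * 1"
    unfolding abs_mult by (intro mult_mono) auto
  then have br: "0 \<le> C\<^sup>2 + C - 2 * sin F * sin (F - \<beta> / 2) * cos (\<beta> / 2)"
    using C \<open>1 \<le> C\<^sup>2\<close> unfolding mult.assoc by linarith
  have "drift C F \<beta> = 4 * cos F * cos (F - \<beta> / 2) * sin (\<beta> / 2)
      * (C\<^sup>2 + C - 2 * sin F * sin (F - \<beta> / 2) * cos (\<beta> / 2))
    / ((C + cos (2 * F - \<beta>)) * (C - cos \<beta>) * (C + cos (2 * F)))"
    using den by (intro drift_eq) (auto simp: less_imp_neq[symmetric])
  also have "\<dots> \<ge> 0"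
    using cF cq by (intro divide_nonneg_pos mult_nonneg_nonneg mult_pos_pos br s den) auto
  finally show ?thesis .
qed

lemma half_le_sin: "y / 2 \<le> sin y" if "0 \<le> y" "y \<le> pi / 3" for y :: real
proof -
  have "sin 0 - 0 / 2 \<le> sin y - y / 2"
  proof (rule DERIV_nonneg_imp_nondecreasing[OF that(1)])
    fix x :: real assume x: "0 \<le> x" "x \<le> y"
    have "cos (pi / 3) \<le> cos x" using x that by (intro cos_monotone_0_pi_le) auto
    then have "0 \<le> cos x - 1 / 2" by (simp add: cos_60)
    moreover have "((\<lambda>x. sin x - x / 2) has_real_derivative cos x - 1 / 2) (at x)"
      by (auto intro!: derivative_eq_intros)
    ultimately show "\<exists>d. ((\<lambda>x. sin x - x / 2) has_real_derivative d) (at x) \<and> 0 \<le> d" by blast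
  qed
  then show ?thesis by simp
qed

text \<open>Since \<open>C\<^sup>2 + C \<ge> 2\<close> and \<open>sin F \<le> sin F0\<close>, the bracket is at least \<open>(1 - sin F0) C\<^sup>2\<close>, while each of the
  three denominators is at most \<open>2 C\<close>: one factor \<open>1 / C\<close> is left. Linearity in \<open>\<beta>\<close> allows the bound to
  be integrated against the mass of the solution.\<close>

lemma drift_lower_bound:
  assumes C: "1 < C" and F: "0 \<le> F" "F \<le> F0" "F0 < pi / 2" and \<beta>: "0 \<le> \<beta>" "\<beta> \<le> F"
  shows "(cos F0)\<^sup>2 * (1 - sin F0) / 8 * \<beta> / C \<le> drift C F \<beta>"
proof -
  have den: "0 < C - cos y" "0 < C + cos y" "C - cos y \<le> 2 * C" "C + cos y \<le> 2 * C" for y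
    using C cos_le_one[of y] cos_ge_minus_one[of y] by linarith+
  have c0: "0 < cos F0" using F by (intro cos_gt_zero_pi) auto
  have c1: "cos F0 \<le> cos F" "cos F0 \<le> cos (F - \<beta> / 2)" using F \<beta> by (auto intro!: cos_monotone_0_pi_le)
  have s0: "0 \<le> 1 - sin F0" by simp
  have s1: "0 \<le> sin F" "sin F \<le> sin F0" using F by (auto intro!: sin_ge_zero sin_monotone_2pi_le)
  have sb: "\<beta> / 4 \<le> sin (\<beta> / 2)" using half_le_sin[of "\<beta> / 2"] \<beta> F by simp
  have C2: "1 \<le> C\<^sup>2" using C by (simp add: one_le_power)
  have "sin F * (sin (F - \<beta> / 2) * cos (\<beta> / 2)) \<le> sin F0 * 1"
  proof (rule mult_mono)
    have "\<bar>sin (F - \<beta> / 2)\<bar> * \<bar>cos (\<beta> / 2)\<bar> \<le> 1 * 1" by (rule mult_mono) auto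
    then show "sin (F - \<beta> / 2) * cos (\<beta> / 2) \<le> 1" by (simp flip: abs_mult)
    show "0 \<le> sin (F - \<beta> / 2) * cos (\<beta> / 2)"
      using F \<beta> by (intro mult_nonneg_nonneg sin_ge_zero cos_ge_zero) auto
  qed (use s1 in auto)
  moreover have "sin F0 * (2 - C) \<le> sin F0 * C\<^sup>2"
    using s1 C2 C by (intro mult_left_mono) linarith+
  moreover have "sin F0 * C \<le> 1 * C"
    using C by (intro mult_right_mono) auto
  ultimately have br: "(1 - sin F0) * C\<^sup>2 \<le> C\<^sup>2 + C - 2 * sin F * sin (F - \<beta> / 2) * cos (\<beta> / 2)"
    by (simp add: algebra_simps)
  have "(cos F0)\<^sup>2 * (1 - sin F0) / 8 * \<beta> / C = (4 * cos F0 * cos F0 * (\<beta> / 4) * ((1 - sin F0) * C\<^sup>2)) / ((2 * C) * (2 * C) * (2 * C))"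
    using C by (simp add: power2_eq_square field_simps)
  also have "\<dots> \<le> 4 * cos F * cos (F - \<beta> / 2) * sin (\<beta> / 2)
      * (C\<^sup>2 + C - 2 * sin F * sin (F - \<beta> / 2) * cos (\<beta> / 2))
    / ((C + cos (2 * F - \<beta>)) * (C - cos \<beta>) * (C + cos (2 * F)))"
    using c0 c1 sb br order_trans[OF mult_nonneg_nonneg[OF s0 zero_le_power2] br] \<beta> s0 C
      less_imp_le[OF den(1)[of \<beta>]] less_imp_le[OF den(2)[of "2 * F"]]
    by (intro frac_le mult_mono mult_nonneg_nonneg mult_pos_pos den) (auto intro: order_trans less_imp_le)
  also have "\<dots> = drift C F \<beta>"
    using den by (intro drift_eq[symmetric]) (auto simp: less_imp_neq[symmetric])
  finally show ?thesis .
qed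

section \<open>The principal value at a maximum\<close>

text \<open>The integrand of the flux when the equation is read as a conservation law: up to the factor \<open>K / 2\<close> its
  derivative in \<open>x\<close> is the integrand of the equation. It is not small for large \<open>\<bar>\<eta>\<bar>\<close>, only its sum over
  \<open>\<eta>\<close> and \<open>- \<eta>\<close> is.\<close>

definition flux :: "real \<Rightarrow> (real \<Rightarrow> real) \<Rightarrow> real \<Rightarrow> real \<Rightarrow> real" where
  "flux l h x \<eta> = arctan (tan (pi / (4 * l) * (h x - h (x - \<eta>))) / tanh (pi / (4 * l) * \<eta>)) +
     arctan (tan (pi / (4 * l) * (h x + h (x - \<eta>))) * tanh (pi / (4 * l) * \<eta>))"

text \<open>The double limit is evaluated along truncations \<open>1 / n\<close> and \<open>n\<close>, and the two half-lines are folded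
  onto each other, so that the cancellation at infinity takes place inside the integrand.\<close>

lemma pv_integral_as_folded_limit:
  assumes pv: "has_pv_integral g I" and g: "\<And>\<eta>. \<eta> \<noteq> 0 \<Longrightarrow> isCont g \<eta>"
  shows "(\<lambda>n. integral {inverse (real (Suc n))..real (Suc n)} (\<lambda>\<eta>. g \<eta> + g (- \<eta>))) \<longlonglongrightarrow> I"
proof -
  have "filterlim (\<lambda>n. (inverse (real (Suc n)), real (Suc n))) (at_right 0 \<times>\<^sub>F at_top) sequentially"
  proof (rule filterlim_Pair)
    show "filterlim (\<lambda>n. inverse (real (Suc n))) (at_right 0) sequentially"
      unfolding filterlim_at using LIMSEQ_inverse_real_of_nat by (auto intro!: always_eventually)
    show "filterlim (\<lambda>n. real (Suc n)) at_top sequentially"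
      using filterlim_compose[OF filterlim_real_sequentially filterlim_Suc] .
  qed
  from filterlim_compose[OF conjunct2[OF pv[unfolded has_pv_integral_def]] this]
  have lim: "(\<lambda>n. LINT \<eta>:{\<eta>. inverse (real (Suc n)) \<le> \<bar>\<eta>\<bar> \<and> \<bar>\<eta>\<bar> \<le> real (Suc n)}|lborel. g \<eta>) \<longlonglongrightarrow> I"
    by simp
  have "(LINT \<eta>:{\<eta>. \<epsilon> \<le> \<bar>\<eta>\<bar> \<and> \<bar>\<eta>\<bar> \<le> R}|lborel. g \<eta>) = integral {\<epsilon>..R} (\<lambda>\<eta>. g \<eta> + g (- \<eta>))"
    if "0 < \<epsilon>" for \<epsilon> R :: real
  proof -
    have "set_integrable lborel {\<eta>. \<epsilon> \<le> \<bar>\<eta>\<bar> \<and> \<bar>\<eta>\<bar> \<le> R} g"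
      using pv that by (auto simp: has_pv_integral_def)
    then have "(LINT \<eta>:{\<eta>. \<epsilon> \<le> \<bar>\<eta>\<bar> \<and> \<bar>\<eta>\<bar> \<le> R}|lborel. g \<eta>) = integral {\<eta>. \<epsilon> \<le> \<bar>\<eta>\<bar> \<and> \<bar>\<eta>\<bar> \<le> R} g"
      by (rule set_borel_integral_eq_integral)
    moreover have "{\<eta>. \<epsilon> \<le> \<bar>\<eta>\<bar> \<and> \<bar>\<eta>\<bar> \<le> R} = {\<epsilon>..R} \<union> {-R..-\<epsilon>}"
      using that by auto
    moreover have int: "g integrable_on {\<epsilon>..R}" "g integrable_on {-R..-\<epsilon>}"
      using that g by (auto intro!: integrable_continuous_real continuous_at_imp_continuous_on)
    moreover from int have "integral ({\<epsilon>..R} \<union> {-R..-\<epsilon>}) g = integral {\<epsilon>..R} g + integral {-R..-\<epsilon>} g"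
    proof (rule integral_Un)
      have "{\<epsilon>..R} \<inter> {-R..-\<epsilon>} = {}" using that by auto
      then show "negligible ({\<epsilon>..R} \<inter> {-R..-\<epsilon>})" by simp
    qed
    moreover have "integral {-R..-\<epsilon>} g = integral {\<epsilon>..R} (\<lambda>\<eta>. g (- \<eta>))"
      using Henstock_Kurzweil_Integration.integral_reflect_real[where b = R and a = \<epsilon> and f = "\<lambda>\<eta>. g (- \<eta>)"] by simp
    moreover have "integral {\<epsilon>..R} (\<lambda>\<eta>. g \<eta> + g (- \<eta>)) = integral {\<epsilon>..R} g + integral {\<epsilon>..R} (\<lambda>\<eta>. g (- \<eta>))"
      using int Henstock_Kurzweil_Integration.integrable_reflect_real[where b = R and a = \<epsilon> and f = "\<lambda>\<eta>. g (- \<eta>)"]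
      by (intro integral_add) auto
    ultimately show ?thesis by simp
  qed
  with lim show ?thesis by simp
qed

lemma scaled_angle:
  assumes "0 < l" "\<bar>v\<bar> < 2 * l"
  shows "\<bar>pi / (4 * l) * v\<bar> < pi / 2"
proof -
  have "pi / (4 * l) * \<bar>v\<bar> < pi / (4 * l) * (2 * l)"
    using assms by (intro mult_strict_left_mono) auto
  then show ?thesis using assms by (simp add: abs_mult)
qed

locale strip_profile =
  fixes l :: real and h :: "real \<Rightarrow> real"
  assumes l_pos: "0 < l"
    and bound: "\<And>y. \<bar>h y\<bar> < l"
    and deriv: "\<And>y. (h has_real_derivative deriv h y) (at y)"
    and cont_deriv: "continuous_on UNIV (deriv h)"
    and decay: "(h \<longlongrightarrow> 0) at_infinity"
begin

lemma cont: "continuous_on UNIV h"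
  using deriv DERIV_isCont continuous_at_imp_continuous_on by blast

lemma isCont_comp: "isCont f x \<Longrightarrow> isCont (\<lambda>x. h (f x)) x" for f :: "real \<Rightarrow> real"
  using continuous_on_eq_continuous_at[of UNIV h] cont isCont_o2[where g = h] by auto

lemma isCont_deriv_comp: "isCont f x \<Longrightarrow> isCont (\<lambda>x. deriv h (f x)) x" for f :: "real \<Rightarrow> real"
  using continuous_on_eq_continuous_at[of UNIV "deriv h"] cont_deriv isCont_o2[where g = "deriv h"] by auto

lemma diff_angle: "\<bar>pi / (4 * l) * (h x - h y)\<bar> < pi / 2"
  using bound[of x] bound[of y] by (intro scaled_angle l_pos) linarith

lemma sum_angle: "\<bar>pi / (4 * l) * (h x + h y)\<bar> < pi / 2"
  using bound[of x] bound[of y] by (intro scaled_angle l_pos) linarith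

lemma angle: "\<bar>pi / (4 * l) * (2 * h x)\<bar> < pi / 2"
  using sum_angle[of x x] by simp

lemma half_angle: "\<bar>pi / (4 * l) * h x\<bar> < pi / 2"
  using diff_angle[of x 0] sum_angle[of x 0] unfolding distrib_left right_diff_distrib by arith

lemma denominators:
  assumes "\<eta> \<noteq> 0"
  shows "0 < cosh (pi / (2 * l) * \<eta>) - cos y" "0 < cosh (pi / (2 * l) * \<eta>) + cos y"
proof -
  have "1 < cosh (pi / (2 * l) * \<eta>)"
    using assms l_pos by (intro cosh_gt_1) auto
  then show "0 < cosh (pi / (2 * l) * \<eta>) - cos y" "0 < cosh (pi / (2 * l) * \<eta>) + cos y"
    using cos_le_one[of y] cos_ge_minus_one[of y] by linarith+
qed

lemma isCont_integrand: "\<eta> \<noteq> 0 \<Longrightarrow> isCont (muskat_integrand l h x) \<eta>"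
  unfolding muskat_integrand_def Xi1_def Xi2_def
  using denominators[of \<eta>]
  by (intro continuous_intros isCont_comp isCont_deriv_comp) (auto simp: less_imp_neq[symmetric] l_pos)

lemma flux_derivative_position:
  assumes "\<eta> \<noteq> 0"
  shows "((\<lambda>x. flux l h x \<eta>) has_real_derivative pi / (4 * l) * muskat_integrand l h x \<eta>) (at x)"
proof -
  have d: "((\<lambda>x. h (x - \<eta>)) has_real_derivative deriv h (x - \<eta>)) (at x)"
    using DERIV_chain2[OF deriv DERIV_diff[OF DERIV_ident DERIV_const]] by simp
  have k: "pi / (4 * l) * \<eta> \<noteq> 0" using assms l_pos by simp
  have dbl: "2 * (pi / (4 * l) * y) = pi / (2 * l) * y" for y by simp
  have alg: "(k * v * S - 0 * s1) / D1 + (k * w * S + 0 * s2) / D2 = k * (v * (S / D1) + w * (S / D2))"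
    for k v w S s1 s2 D1 D2 :: real
    by (simp add: distrib_left)
  show ?thesis
    unfolding flux_def
    by (rule DERIV_cong[OF DERIV_add[OF
          has_derivative_arctan_tan_over_tanh[OF DERIV_const DERIV_cmult[OF DERIV_diff[OF deriv d]] k diff_angle]
          has_derivative_arctan_tan_times_tanh[OF DERIV_const DERIV_cmult[OF DERIV_add[OF deriv d]] sum_angle]]])
      (simp only: dbl muskat_integrand_def Xi1_def Xi2_def alg)
qed

lemma deriv_offset: "((\<lambda>\<eta>. h (x - \<eta>)) has_real_derivative - deriv h (x - \<eta>)) (at \<eta>)"
  using DERIV_chain2[OF deriv DERIV_diff[OF DERIV_const DERIV_ident]] by simp

text \<open>At a critical point the integrand of the equation equals minus \<open>drift\<close>, up to an exact derivative. The
  subtracted arctangent belongs to the constant profile \<open>h(x)\<close> and accounts for the last term of \<open>drift\<close>.\<close>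

lemma flux_derivative_offset:
  assumes "\<eta> \<noteq> 0" and crit: "deriv h x = 0"
  defines "K \<equiv> pi / (2 * l)"
  shows "((\<lambda>\<eta>. flux l h x \<eta> - arctan (tan (pi / (4 * l) * (2 * h x)) * tanh (pi / (4 * l) * \<eta>)))
      has_real_derivative - (pi / (4 * l)) * (muskat_integrand l h x \<eta>
         + drift (cosh (K * \<eta>)) (K * h x) (K * (h x - h (x - \<eta>))))) (at \<eta>)"
proof -
  note d = deriv_offset[of x \<eta>]
  have k: "pi / (4 * l) * \<eta> \<noteq> 0" using assms l_pos by simp
  have dbl: "2 * (pi / (4 * l) * y) = K * y" "K * (2 * h x) = 2 * (K * h x)" for y by (simp_all add: K_def)
  have sum: "2 * (K * h x) - K * (h x - h (x - \<eta>)) = K * (h x + h (x - \<eta>))" by (simp add: algebra_simps)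
  have id: "((\<lambda>\<eta>. pi / (4 * l) * \<eta>) has_real_derivative pi / (4 * l) * 1) (at \<eta>)"
    by (rule DERIV_cmult[OF DERIV_ident])
  have alg: "(k * (0 - - w) * S - k * 1 * s1) / D1 + (k * (0 + - w) * S + k * 1 * s2) / D2 - (0 * S + k * 1 * s3) / D3
     = - k * ((0 - w) * (S / D1) + (0 + w) * (S / D2) + (s1 / D1 - s2 / D2 + s3 / D3))"
    for k w S s1 s2 s3 D1 D2 D3 :: real
    by (simp add: algebra_simps add_divide_distrib diff_divide_distrib)
  show ?thesis
    unfolding flux_def
    apply (rule DERIV_cong[OF DERIV_diff[OF DERIV_add[OF
          has_derivative_arctan_tan_over_tanh[OF id DERIV_cmult[OF DERIV_diff[OF DERIV_const d]] k diff_angle]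
          has_derivative_arctan_tan_times_tanh[OF id DERIV_cmult[OF DERIV_add[OF DERIV_const d]] sum_angle]]
          has_derivative_arctan_tan_times_tanh[OF id DERIV_const angle]]])
    unfolding dbl muskat_integrand_def Xi1_def Xi2_def crit K_def[symmetric] drift_def sum
    by (rule alg)
qed

lemma tendsto_shift:
  assumes "filterlim f at_infinity F"
  shows "((\<lambda>\<eta>. h (f \<eta>)) \<longlongrightarrow> 0) F"
  using filterlim_compose[OF decay assms] .

lemma tanh_scaled_at_top: "((\<lambda>\<eta>. tanh (pi / (4 * l) * \<eta>)) \<longlongrightarrow> 1) at_top"
  by (rule filterlim_compose[OF tanh_real_at_top])
     (use l_pos in \<open>intro filterlim_tendsto_pos_mult_at_top[OF tendsto_const _ filterlim_ident], simp\<close>)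

text \<open>The next three limits are the boundary values of the primitive. At infinity they agree with those of
  the constant profile because \<open>h\<close> decays; at the origin the quotient in \<open>flux\<close> tends to a multiple of
  \<open>h'(x) = 0\<close>.\<close>

lemma flux_tendsto_at_top: "(flux l h x \<longlongrightarrow> pi / (4 * l) * (2 * h x)) at_top"
proof -
  have "filterlim (\<lambda>\<eta>::real. x - \<eta>) at_bot at_top"
    unfolding filterlim_uminus_at_bot
    using filterlim_tendsto_add_at_top[OF tendsto_const filterlim_ident, of "-x"] by simp
  then have "filterlim (\<lambda>\<eta>::real. x - \<eta>) at_infinity at_top"
    by (rule filterlim_mono) (auto simp: at_infinity_eq_at_top_bot)
  then have h: "((\<lambda>\<eta>. h (x - \<eta>)) \<longlongrightarrow> 0) at_top" by (rule tendsto_shift)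
  have c: "cos (pi / (4 * l) * h x) \<noteq> 0"
    using cos_pos_of_abs[OF half_angle[of x]] by simp
  have "(flux l h x \<longlongrightarrow> arctan (tan (pi / (4 * l) * (h x - 0)) / 1) + arctan (tan (pi / (4 * l) * (h x + 0)) * 1)) at_top"
    unfolding flux_def
    by (intro tendsto_intros h tanh_scaled_at_top) (use c in auto)
  also have "arctan (tan (pi / (4 * l) * (h x - 0)) / 1) + arctan (tan (pi / (4 * l) * (h x + 0)) * 1) = pi / (4 * l) * (2 * h x)"
    using arctan_tan_of_abs[OF half_angle[of x]] by simp
  finally show ?thesis .
qed

lemma flux_tendsto_at_bot: "((\<lambda>\<eta>. flux l h x (- \<eta>)) \<longlongrightarrow> - (pi / (4 * l) * (2 * h x))) at_top"
proof -
  have "filterlim (\<lambda>\<eta>::real. x - (- \<eta>)) at_top at_top"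
    using filterlim_tendsto_add_at_top[OF tendsto_const filterlim_ident, of x] by simp
  then have "filterlim (\<lambda>\<eta>::real. x - (- \<eta>)) at_infinity at_top"
    by (rule filterlim_mono) (auto simp: at_infinity_eq_at_top_bot)
  then have h: "((\<lambda>\<eta>. h (x - (- \<eta>))) \<longlongrightarrow> 0) at_top" by (rule tendsto_shift)
  have c: "cos (pi / (4 * l) * h x) \<noteq> 0"
    using cos_pos_of_abs[OF half_angle[of x]] by simp
  have t: "((\<lambda>\<eta>. tanh (pi / (4 * l) * - \<eta>)) \<longlongrightarrow> - 1) at_top"
    using tendsto_minus[OF tanh_scaled_at_top] by simp
  have "((\<lambda>\<eta>. flux l h x (- \<eta>)) \<longlongrightarrow> arctan (tan (pi / (4 * l) * (h x - 0)) / - 1) + arctan (tan (pi / (4 * l) * (h x + 0)) * - 1)) at_top"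
    unfolding flux_def
    by (intro tendsto_intros h t) (use c in auto)
  also have "arctan (tan (pi / (4 * l) * (h x - 0)) / - 1) + arctan (tan (pi / (4 * l) * (h x + 0)) * - 1) = - (pi / (4 * l) * (2 * h x))"
    using arctan_tan_of_abs[OF half_angle[of x]] by (simp add: arctan_minus)
  finally show ?thesis .
qed

lemma flux_tendsto_0:
  assumes crit: "deriv h x = 0"
  shows "((\<lambda>\<eta>. flux l h x \<eta>) \<longlongrightarrow> 0) (at 0)"
proof -
  define k where "k = pi / (4 * l)"
  have k: "k \<noteq> 0" using l_pos by (simp add: k_def)
  note d = deriv_offset[of x 0]
  have inner: "((\<lambda>\<eta>. k * (h x - h (x - \<eta>))) has_real_derivative 0) (at 0)"
    using DERIV_cmult[OF DERIV_diff[OF DERIV_const d], of k] crit by simp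
  have "((\<lambda>\<eta>. tan (k * (h x - h (x - \<eta>)))) has_real_derivative 0) (at 0)"
    using DERIV_chain2[OF DERIV_tan inner] by simp
  then have 1: "((\<lambda>\<eta>. tan (k * (h x - h (x - \<eta>))) / \<eta>) \<longlongrightarrow> 0) (at 0)"
    by (simp add: has_field_derivative_iff)
  have "((\<lambda>\<eta>. tanh (k * \<eta>)) has_real_derivative k) (at 0)"
    by (rule derivative_eq_intros refl)+ simp_all
  then have 2: "((\<lambda>\<eta>. tanh (k * \<eta>) / \<eta>) \<longlongrightarrow> k) (at 0)"
    by (simp add: has_field_derivative_iff)
  have "((\<lambda>\<eta>. (tan (k * (h x - h (x - \<eta>))) / \<eta>) / (tanh (k * \<eta>) / \<eta>)) \<longlongrightarrow> 0 / k) (at 0)"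
    by (intro tendsto_divide 1 2 k)
  then have "((\<lambda>\<eta>. (tan (k * (h x - h (x - \<eta>))) / \<eta>) / (tanh (k * \<eta>) / \<eta>)) \<longlongrightarrow> 0) (at 0)"
    by simp
  then have 3: "((\<lambda>\<eta>. tan (k * (h x - h (x - \<eta>))) / tanh (k * \<eta>)) \<longlongrightarrow> 0) (at 0)"
    by (rule Lim_transform_eventually) (auto simp: eventually_at_filter)
  have c: "cos (k * (h x + h x)) \<noteq> 0"
    using cos_pos_of_abs[OF sum_angle[of x x]] by (simp add: k_def)
  have "((\<lambda>\<eta>. h (x - \<eta>)) \<longlongrightarrow> h (x - 0)) (at 0)"
    using d DERIV_isCont isCont_def by blast
  then have "((\<lambda>\<eta>. tan (k * (h x + h (x - \<eta>))) * tanh (k * \<eta>)) \<longlongrightarrow> tan (k * (h x + h (x - 0))) * tanh (k * 0)) (at 0)"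
    by (intro tendsto_intros) (use c in auto)
  then have 4: "((\<lambda>\<eta>. tan (k * (h x + h (x - \<eta>))) * tanh (k * \<eta>)) \<longlongrightarrow> 0) (at 0)" by simp
  show ?thesis
    using tendsto_add[OF tendsto_arctan[OF 3] tendsto_arctan[OF 4]] by (simp add: flux_def k_def)
qed

lemma isCont_drift:
  assumes "\<eta> \<noteq> 0"
  shows "isCont (\<lambda>\<eta>. drift (cosh (pi / (2 * l) * \<eta>)) (pi / (2 * l) * h x)
    (pi / (2 * l) * (h x - h (x - \<eta>)))) \<eta>"
  unfolding drift_def
  using denominators[OF assms] by (intro continuous_intros isCont_comp) (auto simp: less_imp_neq[symmetric] l_pos)

text \<open>The truncated integrals equal minus the integral of \<open>drift\<close> plus boundary terms that vanish in the
  limit. Since \<open>drift\<close> is nonnegative, any window \<open>a \<le> \<bar>\<eta>\<bar> \<le> b\<close> gives an upper bound.\<close>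

lemma pv_integral_at_maximum:
  assumes pv: "has_pv_integral (muskat_integrand l h x) I" and max: "\<And>y. h y \<le> h x"
    and ab: "0 < a" "a \<le> b"
  defines "K \<equiv> pi / (2 * l)"
  defines "p \<equiv> \<lambda>\<eta>. drift (cosh (K * \<eta>)) (K * h x) (K * (h x - h (x - \<eta>)))"
  shows "I \<le> - integral {a..b} (\<lambda>\<eta>. p \<eta> + p (- \<eta>))"
proof -
  have crit: "deriv h x = 0"
    using DERIV_local_max[OF deriv[of x], of 1] max by simp
  define k where "k = pi / (4 * l)"
  have k: "k > 0" using l_pos by (simp add: k_def)
  have K: "K = 2 * k" by (simp add: K_def k_def)
  have pos: "0 \<le> p \<eta>" if "\<eta> \<noteq> 0" for \<eta>
    unfolding p_def
  proof (rule drift_nonneg)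
    show "1 < cosh (K * \<eta>)" using that l_pos by (intro cosh_gt_1) (simp add: K_def)
    have F: "K * h x = pi / (4 * l) * (2 * h x)" by (simp add: K_def)
    show "\<bar>K * h x\<bar> < pi / 2" unfolding F by (rule angle)
    have \<beta>: "K * (h x - h (x - \<eta>)) / 2 = pi / (4 * l) * (h x - h (x - \<eta>))" by (simp add: K_def)
    show "0 \<le> K * (h x - h (x - \<eta>)) / 2"
      using k max[of "x - \<eta>"] by (simp add: K)
    show "K * (h x - h (x - \<eta>)) / 2 \<le> pi"
      using diff_angle[of x "x - \<eta>"] pi_gt_zero unfolding \<beta> by linarith
    have q: "K * h x - K * (h x - h (x - \<eta>)) / 2 = pi / (4 * l) * (h x + h (x - \<eta>))"
      unfolding K k_def[symmetric] by (simp add: field_simps)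
    show "\<bar>K * h x - K * (h x - h (x - \<eta>)) / 2\<bar> < pi / 2" unfolding q by (rule sum_angle)
  qed
  have cont_p: "isCont p \<eta>" if "\<eta> \<noteq> 0" for \<eta>
    unfolding p_def K_def by (rule isCont_drift[OF that])
  define g where "g = muskat_integrand l h x"
  have cont_g: "isCont g \<eta>" if "\<eta> \<noteq> 0" for \<eta>
    unfolding g_def using isCont_integrand[OF that] .
  define B where "B = (\<lambda>\<eta>. flux l h x \<eta> - arctan (tan (k * (2 * h x)) * tanh (k * \<eta>)))"
  define E where "E = (\<lambda>\<eta>. B \<eta> - B (- \<eta>))"
  have dB: "(B has_real_derivative - k * (g \<eta> + p \<eta>)) (at \<eta>)" if "\<eta> \<noteq> 0" for \<eta>
    using flux_derivative_offset[OF that crit] by (simp add: B_def k_def g_def p_def K_def)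
  have dB': "((\<lambda>\<eta>. B (- \<eta>)) has_real_derivative k * (g (- \<eta>) + p (- \<eta>))) (at \<eta>)" if "\<eta> \<noteq> 0" for \<eta>
    using DERIV_chain2[OF dB DERIV_minus[OF DERIV_ident], of \<eta>] that by simp
  have dE: "(E has_real_derivative - k * ((g \<eta> + g (- \<eta>)) + (p \<eta> + p (- \<eta>)))) (at \<eta>)" if "\<eta> \<noteq> 0" for \<eta>
    unfolding E_def using DERIV_diff[OF dB[OF that] dB'[OF that]] by (simp add: algebra_simps)
  have cont2: "continuous_on {\<epsilon>..R} (\<lambda>\<eta>. f \<eta> + f (- \<eta>))"
    if "\<And>\<eta>. \<eta> \<noteq> 0 \<Longrightarrow> isCont f \<eta>" "0 < \<epsilon>" for f :: "real \<Rightarrow> real" and \<epsilon> R :: real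
    using that isCont_o2[of _ uminus f]
    by (intro continuous_at_imp_continuous_on ballI continuous_intros) auto
  have J: "integral {\<epsilon>..R} (\<lambda>\<eta>. g \<eta> + g (- \<eta>)) + (E R - E \<epsilon>) / k \<le> - integral {a..b} (\<lambda>\<eta>. p \<eta> + p (- \<eta>))"
    if "0 < \<epsilon>" "\<epsilon> \<le> a" "b \<le> R" for \<epsilon> R
  proof -
    have ig: "(\<lambda>\<eta>. g \<eta> + g (- \<eta>)) integrable_on {\<epsilon>..R}" and ip: "(\<lambda>\<eta>. p \<eta> + p (- \<eta>)) integrable_on {\<epsilon>..R}"
      using that cont2[OF cont_g] cont2[OF cont_p] by (auto intro!: integrable_continuous_real)
    have "((\<lambda>\<eta>. - k * ((g \<eta> + g (- \<eta>)) + (p \<eta> + p (- \<eta>)))) has_integral E R - E \<epsilon>) {\<epsilon>..R}"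
    proof (rule fundamental_theorem_of_calculus)
      fix \<eta> assume "\<eta> \<in> {\<epsilon>..R}"
      then have "\<eta> \<noteq> 0" using that by auto
      from dE[OF this] show "(E has_vector_derivative - k * ((g \<eta> + g (- \<eta>)) + (p \<eta> + p (- \<eta>)))) (at \<eta> within {\<epsilon>..R})"
        unfolding has_real_derivative_iff_has_vector_derivative by (rule has_vector_derivative_at_within)
    qed (use that ab in auto)
    moreover have "((\<lambda>\<eta>. - k * ((g \<eta> + g (- \<eta>)) + (p \<eta> + p (- \<eta>)))) has_integral
       - k * (integral {\<epsilon>..R} (\<lambda>\<eta>. g \<eta> + g (- \<eta>)) + integral {\<epsilon>..R} (\<lambda>\<eta>. p \<eta> + p (- \<eta>)))) {\<epsilon>..R}"
      using ig ip by (intro has_integral_mult_right has_integral_add integrable_integral)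
    ultimately have "E R - E \<epsilon> = - k * (integral {\<epsilon>..R} (\<lambda>\<eta>. g \<eta> + g (- \<eta>)) + integral {\<epsilon>..R} (\<lambda>\<eta>. p \<eta> + p (- \<eta>)))"
      by (rule has_integral_unique)
    then have "integral {\<epsilon>..R} (\<lambda>\<eta>. g \<eta> + g (- \<eta>)) + (E R - E \<epsilon>) / k = - integral {\<epsilon>..R} (\<lambda>\<eta>. p \<eta> + p (- \<eta>))"
      using k by (simp add: field_simps)
    moreover have "integral {a..b} (\<lambda>\<eta>. p \<eta> + p (- \<eta>)) \<le> integral {\<epsilon>..R} (\<lambda>\<eta>. p \<eta> + p (- \<eta>))"
      using that ab ip pos
      by (intro integral_subset_le integrable_on_subinterval[OF ip] add_nonneg_nonneg) auto
    ultimately show ?thesis by simp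
  qed
  have lim_R: "(E \<longlongrightarrow> 0) at_top"
  proof -
    have at: "arctan (tan (k * (2 * h x))) = k * (2 * h x)"
      unfolding k_def by (rule arctan_tan_of_abs[OF angle])
    have "((\<lambda>\<eta>. arctan (tan (k * (2 * h x)) * tanh (k * \<eta>))) \<longlongrightarrow> arctan (tan (k * (2 * h x)) * 1)) at_top"
      using tanh_scaled_at_top by (intro tendsto_intros) (simp add: k_def)
    then have far: "((\<lambda>\<eta>. arctan (tan (k * (2 * h x)) * tanh (k * \<eta>))) \<longlongrightarrow> k * (2 * h x)) at_top"
      by (simp add: at)
    have E: "E = (\<lambda>\<eta>. (flux l h x \<eta> - arctan (tan (k * (2 * h x)) * tanh (k * \<eta>)))
        - (flux l h x (- \<eta>) + arctan (tan (k * (2 * h x)) * tanh (k * \<eta>))))"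
      by (simp add: E_def B_def arctan_minus fun_eq_iff)
    have "(E \<longlongrightarrow> (k * (2 * h x) - k * (2 * h x)) - (- (k * (2 * h x)) + k * (2 * h x))) at_top"
      unfolding E k_def
      by (intro tendsto_diff[OF tendsto_diff tendsto_add] flux_tendsto_at_top flux_tendsto_at_bot far[unfolded k_def])
    then show ?thesis by simp
  qed
  have lim_0: "(E \<longlongrightarrow> 0) (at 0)"
  proof -
    have "((\<lambda>\<eta>. arctan (tan (k * (2 * h x)) * tanh (k * \<eta>))) \<longlongrightarrow> arctan (tan (k * (2 * h x)) * tanh (k * 0))) (at 0)"
      by (intro tendsto_intros) auto
    then have B0: "(B \<longlongrightarrow> 0) (at 0)"
      unfolding B_def using tendsto_diff[OF flux_tendsto_0[OF crit]] by fastforce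
    have "filterlim (\<lambda>\<eta>::real. - \<eta>) (at 0) (at 0)"
      unfolding filterlim_at by (auto intro!: tendsto_eq_intros simp: eventually_at_filter)
    from tendsto_diff[OF B0 filterlim_compose[OF B0 this]] show ?thesis by (simp add: E_def)
  qed
  have s0: "filterlim (\<lambda>n. inverse (real (Suc n))) (at 0) sequentially"
    unfolding filterlim_at using LIMSEQ_inverse_real_of_nat by (auto intro!: always_eventually)
  have sR: "filterlim (\<lambda>n. real (Suc n)) at_top sequentially"
    using filterlim_compose[OF filterlim_real_sequentially filterlim_Suc] .
  have "(\<lambda>n. integral {inverse (real (Suc n))..real (Suc n)} (\<lambda>\<eta>. g \<eta> + g (- \<eta>))
       + (E (real (Suc n)) - E (inverse (real (Suc n)))) / k) \<longlonglongrightarrow> I + (0 - 0) / k"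
    using k pv_integral_as_folded_limit[OF pv isCont_integrand]
    by (intro tendsto_intros filterlim_compose[OF lim_R sR] filterlim_compose[OF lim_0 s0]) (auto simp: g_def)
  then have "(\<lambda>n. integral {inverse (real (Suc n))..real (Suc n)} (\<lambda>\<eta>. g \<eta> + g (- \<eta>))
       + (E (real (Suc n)) - E (inverse (real (Suc n)))) / k) \<longlonglongrightarrow> I" by simp
  then show "I \<le> - integral {a..b} (\<lambda>\<eta>. p \<eta> + p (- \<eta>))"
  proof (rule tendsto_upperbound)
    show "\<forall>\<^sub>F n in sequentially. integral {inverse (real (Suc n))..real (Suc n)} (\<lambda>\<eta>. g \<eta> + g (- \<eta>))
       + (E (real (Suc n)) - E (inverse (real (Suc n)))) / k \<le> - integral {a..b} (\<lambda>\<eta>. p \<eta> + p (- \<eta>))"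
      using order_tendstoD(2)[OF LIMSEQ_inverse_real_of_nat ab(1)] sR[unfolded filterlim_at_top, rule_format, of b]
    proof eventually_elim
      case (elim n)
      then show ?case by (intro J) auto
    qed
  qed simp
qed

end

section \<open>The flux and its decay\<close>

text \<open>For \<open>c = 1\<close> the quotient is \<open>coth (y / 2)\<close>, and decreasing \<open>c\<close> only increases the denominator.\<close>

lemma coth_half_bound:
  fixes y c :: real
  assumes "y \<noteq> 0" "c \<le> 1"
  shows "\<bar>sinh y / (cosh y - c)\<bar> \<le> 2 / \<bar>y\<bar> + 1"
proof -
  define z where "z = \<bar>y\<bar>"
  have z: "0 < z" using assms by (simp add: z_def)
  have c1: "1 < cosh z" using z by (intro cosh_gt_1) auto
  have "0 \<le> 2 * ((exp z - 1) * exp (- z)) * (exp z - 1 - z)"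
    using z exp_ge_add_one_self[of z] by (intro mult_nonneg_nonneg) (auto simp: algebra_simps)
  also have "\<dots> = 2 * ((2 + z) * (cosh z - 1) - z * sinh z)"
    using exp_minus_inverse[of z] unfolding cosh_def sinh_def by (simp add: scaleR_conv_of_real) algebra
  finally have key: "z * sinh z \<le> (2 + z) * (cosh z - 1)" by simp
  have "\<bar>sinh y / (cosh y - c)\<bar> = sinh z / (cosh z - c)"
  proof -
    have s: "\<bar>sinh y\<bar> = sinh z" by (cases "y > 0") (auto simp: z_def)
    have c: "cosh y = cosh z" by (simp add: z_def cosh_real_abs)
    show ?thesis unfolding abs_divide s c using assms c1 by simp
  qed
  also have "\<dots> \<le> sinh z / (cosh z - 1)"
    using c1 z assms by (intro divide_left_mono mult_pos_pos) auto
  also have "\<dots> \<le> (2 + z) / z"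
    using key c1 z by (simp add: divide_simps mult.commute)
  also have "\<dots> = 2 / \<bar>y\<bar> + 1" using z by (simp add: z_def[symmetric] add_divide_distrib)
  finally show ?thesis .
qed

lemma coth_half_tail:
  fixes y c K :: real
  assumes K: "0 < K" "K \<le> \<bar>y\<bar>" and c: "\<bar>c\<bar> \<le> 1"
  shows "\<bar>sinh y / (cosh y - c) - sgn y\<bar> \<le> 4 / (1 - exp (- K))\<^sup>2 * exp (- \<bar>y\<bar>)"
proof -
  define z where "z = \<bar>y\<bar>"
  have z: "0 < z" "K \<le> z" using assms by (auto simp: z_def)
  have c1: "1 < cosh z" using z by (intro cosh_gt_1) auto
  have eK: "0 < 1 - exp (- K)" "1 - exp (- K) \<le> 1 - exp (- z)" using z K by auto
  have e1: "exp z * exp (- z) = 1" by (simp add: exp_minus_inverse)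
  have "\<bar>sinh y / (cosh y - c) - sgn y\<bar> = \<bar>sinh z / (cosh z - c) - 1\<bar>"
    using z by (cases "y > 0") (auto simp: z_def abs_if)
  also have "sinh z / (cosh z - c) - 1 = (c - exp (- z)) / (cosh z - c)"
    using c1 c by (simp add: cosh_minus_sinh[symmetric] field_simps)
  also have "\<bar>\<dots>\<bar> \<le> 2 / (cosh z - 1)"
  proof -
    have "exp (- z) \<le> 1" "0 < exp (- z)" using z by auto
    then have "\<bar>c - exp (- z)\<bar> \<le> 2" using c by linarith
    moreover have "cosh z - 1 \<le> \<bar>cosh z - c\<bar>" using c by linarith
    ultimately show ?thesis unfolding abs_divide using c1 by (intro frac_le) auto
  qed
  also have "\<dots> = 4 / (1 - exp (- z))\<^sup>2 * exp (- z)"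
  proof -
    have D: "(1 - exp (- z))\<^sup>2 = (2 * (cosh z - 1)) * exp (- z)"
      using e1 unfolding cosh_def by (simp add: scaleR_conv_of_real) algebra
    have "0 < cosh z - 1" "0 < exp (- z)" using c1 by auto
    moreover have "2 / X = 4 / (2 * X * w) * w" if "0 < X" "0 < w" for X w :: real
      using that by (simp add: divide_simps)
    ultimately show ?thesis unfolding D by blast
  qed
  also have "\<dots> \<le> 4 / (1 - exp (- K))\<^sup>2 * exp (- z)"
    using eK by (intro mult_right_mono divide_left_mono power_mono mult_pos_pos) auto
  finally show ?thesis by (simp add: z_def)
qed

lemma arctan_Lipschitz: "\<bar>arctan u - arctan v\<bar> \<le> \<bar>u - v\<bar>" for u v :: real
proof -
  have "norm (arctan u - arctan v) \<le> 1 * norm (u - v)"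
  proof (rule field_differentiable_bound[where S = UNIV and f = arctan and f' = "\<lambda>x. inverse (1 + x\<^sup>2)"])
    fix z :: real
    have "1 \<le> 1 + z\<^sup>2" by simp
    then show "norm (inverse (1 + z\<^sup>2)) \<le> 1"
      using le_imp_inverse_le[of 1 "1 + z\<^sup>2"] by simp
  qed (auto intro: DERIV_arctan has_field_derivative_at_within)
  then show ?thesis by simp
qed

lemma abs_tan_le:
  fixes b \<beta> :: real
  assumes "\<bar>b\<bar> \<le> \<beta>" "\<beta> < pi / 2"
  shows "\<bar>tan b\<bar> \<le> tan \<beta>"
  using assms tan_mono_le[of b \<beta>] tan_mono_le[of "- b" \<beta>] by (simp add: abs_le_iff)

text \<open>Replacing \<open>tanh a\<close> by its limit 1 turns the left-hand arctangents into \<open>b1\<close> and \<open>b2\<close>; the error is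
  controlled by \<open>1 - tanh a\<close> because the arctangent is a contraction.\<close>

lemma arctan_pair_tail:
  fixes a b1 b2 \<beta> K :: real
  assumes K: "0 < K" "K \<le> 2 * a" and b: "\<bar>b1\<bar> \<le> \<beta>" "\<bar>b2\<bar> \<le> \<beta>" "\<beta> < pi / 2"
  shows "\<bar>arctan (tan b1 / tanh a) + arctan (tan b2 * tanh a) - (b1 + b2)\<bar>
    \<le> 4 * tan \<beta> / (1 - exp (- K)) * exp (- (2 * a))"
proof -
  have a: "0 < a" using K by simp
  define w where "w = exp (- (2 * a))"
  have w: "0 < w" "w \<le> exp (- K)" "exp (- K) < 1" using K by (auto simp: w_def)
  have w1: "w < 1" using w by linarith
  have th: "tanh a = (1 - w) / (1 + w)"
    unfolding w_def tanh_real_altdef by simp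
  have e1: "\<bar>arctan (tan b1 / tanh a) - b1\<bar> \<le> tan \<beta> * (2 * w / (1 - exp (- K)))"
  proof -
    have "\<bar>arctan (tan b1 / tanh a) - b1\<bar> = \<bar>arctan (tan b1 / tanh a) - arctan (tan b1)\<bar>"
      using b by (subst arctan_tan_of_abs) auto
    also have "\<dots> \<le> \<bar>tan b1 / tanh a - tan b1\<bar>" by (rule arctan_Lipschitz)
    also have "\<dots> = \<bar>tan b1\<bar> * (2 * w / (1 - w))"
    proof -
      have "tan b1 / tanh a - tan b1 = tan b1 * (2 * w / (1 - w))"
        using w w1 unfolding th by (simp add: divide_simps) (simp add: algebra_simps)
      then show ?thesis using w w1 by (simp add: abs_mult)
    qed
    also have "\<dots> \<le> tan \<beta> * (2 * w / (1 - exp (- K)))"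
      using w w1 abs_tan_le[OF b(1,3)] by (intro mult_mono divide_left_mono mult_pos_pos) auto
    finally show ?thesis .
  qed
  have e2: "\<bar>arctan (tan b2 * tanh a) - b2\<bar> \<le> tan \<beta> * (2 * w / (1 - exp (- K)))"
  proof -
    have "\<bar>arctan (tan b2 * tanh a) - b2\<bar> = \<bar>arctan (tan b2 * tanh a) - arctan (tan b2)\<bar>"
      using b by (subst arctan_tan_of_abs) auto
    also have "\<dots> \<le> \<bar>tan b2 * tanh a - tan b2\<bar>" by (rule arctan_Lipschitz)
    also have "\<dots> = \<bar>tan b2\<bar> * (2 * w / (1 + w))"
    proof -
      have "tan b2 * tanh a - tan b2 = - (tan b2 * (2 * w / (1 + w)))"
        using w w1 unfolding th by (simp add: divide_simps) (simp add: algebra_simps)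
      then show ?thesis using w w1 by (simp add: abs_mult)
    qed
    also have "\<dots> \<le> tan \<beta> * (2 * w / (1 - exp (- K)))"
      using w w1 abs_tan_le[OF b(2,3)] by (intro mult_mono divide_left_mono mult_pos_pos) auto
    finally show ?thesis .
  qed
  have "\<bar>arctan (tan b1 / tanh a) + arctan (tan b2 * tanh a) - (b1 + b2)\<bar>
      \<le> 2 * (tan \<beta> * (2 * w / (1 - exp (- K))))"
    using e1 e2 by linarith
  then show ?thesis by (simp add: w_def)
qed

text \<open>For \<open>\<eta> \<le> 1\<close> the arctangents are bounded. For larger \<open>\<eta>\<close> the flux integrand at \<open>\<plusminus> \<eta>\<close> is exponentially
  close to \<open>\<plusminus> K h(x)\<close>, and these two values cancel. The constant depends on the profile through its
  amplitude only, which is what makes it uniform along a solution.\<close>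

lemma folded_flux_bound:
  fixes l m :: real
  assumes l: "0 < l" and m: "0 \<le> m" "m < l"
  shows "\<exists>C. \<forall>h x \<eta>. (\<forall>y. \<bar>h y\<bar> \<le> m) \<longrightarrow> 0 < \<eta> \<longrightarrow>
    \<bar>flux l h x \<eta> + flux l h x (- \<eta>)\<bar> \<le> C * exp (- (pi / (2 * l)) * \<eta>)"
proof -
  define k K where "k = pi / (4 * l)" and "K = pi / (2 * l)"
  have k: "0 < k" "K = 2 * k" "0 < K" using l by (auto simp: k_def K_def)
  have Km: "K * m < pi / 2"
    using m l by (simp add: K_def field_simps)
  define T where "T = 2 * (4 * tan (K * m) / (1 - exp (- K)))"
  have tan0: "0 \<le> tan (K * m)" using tan_mono_le[of 0 "K * m"] Km k m by simp
  have T: "0 \<le> T" using tan0 k by (auto simp: T_def)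
  define C where "C = 2 * pi * exp K + T"
  have "\<bar>flux l h x \<eta> + flux l h x (- \<eta>)\<bar> \<le> C * exp (- K * \<eta>)"
    if h: "\<And>y. \<bar>h y\<bar> \<le> m" and \<eta>: "0 < \<eta>" for h x \<eta>
  proof (cases "\<eta> \<le> 1")
    case True
    have "\<bar>flux l h x z\<bar> \<le> pi" for z
      unfolding flux_def
      using arctan_ubound[of "tan (pi / (4 * l) * (h x - h (x - z))) / tanh (pi / (4 * l) * z)"]
        arctan_lbound[of "tan (pi / (4 * l) * (h x - h (x - z))) / tanh (pi / (4 * l) * z)"]
        arctan_ubound[of "tan (pi / (4 * l) * (h x + h (x - z))) * tanh (pi / (4 * l) * z)"]
        arctan_lbound[of "tan (pi / (4 * l) * (h x + h (x - z))) * tanh (pi / (4 * l) * z)"]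
      by linarith
    from this[of \<eta>] this[of "- \<eta>"] have "\<bar>flux l h x \<eta> + flux l h x (- \<eta>)\<bar> \<le> 2 * pi * 1" by linarith
    also have "\<dots> \<le> 2 * pi * exp (K + - K * \<eta>)"
      using True k by (intro mult_left_mono) auto
    also have "\<dots> = 2 * pi * exp K * exp (- K * \<eta>)"
      by (simp only: exp_add mult.assoc)
    also have "\<dots> \<le> C * exp (- K * \<eta>)"
      using T by (intro mult_right_mono) (auto simp: C_def)
    finally show ?thesis .
  next
    case False
    have ang: "\<bar>k * (h x - h y)\<bar> \<le> K * m" "\<bar>k * (h x + h y)\<bar> \<le> K * m" for y
    proof -
      have "\<bar>h x - h y\<bar> \<le> 2 * m" "\<bar>h x + h y\<bar> \<le> 2 * m" using h[of x] h[of y] by linarith+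
      then show "\<bar>k * (h x - h y)\<bar> \<le> K * m" "\<bar>k * (h x + h y)\<bar> \<le> K * m"
        using k by (auto simp: abs_mult)
    qed
    have kk: "K \<le> 2 * (k * \<eta>)" using False k by simp
    have "\<bar>arctan (tan (k * (h x - h y)) / tanh (k * \<eta>)) + arctan (tan (k * (h x + h y)) * tanh (k * \<eta>))
       - (k * (h x - h y) + k * (h x + h y))\<bar> \<le> T / 2 * exp (- K * \<eta>)" for y
    proof -
      have T2: "T / 2 = 4 * tan (K * m) / (1 - exp (- K))"
        unfolding T_def by (rule nonzero_mult_div_cancel_left) simp
      have e: "- K * \<eta> = - (2 * (k * \<eta>))" by (simp add: k(2))
      show ?thesis
        unfolding T2 e by (rule arctan_pair_tail[OF k(3) kk ang(1)[of y] ang(2)[of y] Km])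
    qed
    note that = this
    have tail: "\<bar>arctan (tan (k * (h x - h y)) / tanh (k * \<eta>)) + arctan (tan (k * (h x + h y)) * tanh (k * \<eta>))
       - K * h x\<bar> \<le> T / 2 * exp (- K * \<eta>)" for y
    proof -
      have "k * (h x - h y) + k * (h x + h y) = K * h x" by (simp add: k(2) algebra_simps)
      with that[of y] show ?thesis by simp
    qed
    have 1: "\<bar>flux l h x \<eta> - K * h x\<bar> \<le> T / 2 * exp (- K * \<eta>)"
      using tail[of "x - \<eta>"] by (simp add: flux_def k_def)
    have 2: "\<bar>flux l h x (- \<eta>) + K * h x\<bar> \<le> T / 2 * exp (- K * \<eta>)"
    proof -
      have "flux l h x (- \<eta>) = - (arctan (tan (k * (h x - h (x + \<eta>))) / tanh (k * \<eta>))
          + arctan (tan (k * (h x + h (x + \<eta>))) * tanh (k * \<eta>)))"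
        by (simp add: flux_def k_def arctan_minus)
      with tail[of "x + \<eta>"] show ?thesis by linarith
    qed
    have "\<bar>flux l h x \<eta> + flux l h x (- \<eta>)\<bar> \<le> T * exp (- K * \<eta>)" using 1 2 by linarith
    also have "\<dots> \<le> C * exp (- K * \<eta>)" by (intro mult_right_mono) (auto simp: C_def)
    finally show ?thesis .
  qed
  then show ?thesis unfolding K_def by blast
qed

lemma exp_decay_integrable: "0 < K \<Longrightarrow> (\<lambda>\<eta>. C * exp (- K * \<eta>)) integrable_on {0..}" for K C :: real
  using has_integral_mult_right[OF has_integral_exp_minus_to_infinity[of K 0], of C] by (rule has_integral_integrable)

text \<open>A profile that is small on a large neighbourhood of \<open>x\<close> has a small flux at \<open>x\<close>. Otherwise there would be
  profiles that are smaller and smaller on larger and larger neighbourhoods but whose fluxes stay above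
  \<open>e\<close>; their flux integrands tend to 0 pointwise and are dominated by one exponential. The truncations
  \<open>a\<close> and \<open>b\<close> may vary along the sequence, so they are absorbed into the integrands.\<close>

lemma integral_folded_flux_small:
  fixes l m e :: real
  assumes l: "0 < l" and m: "0 \<le> m" "m < l" and e: "0 < e"
  shows "\<exists>n. \<forall>h x. continuous_on UNIV h \<longrightarrow> (\<forall>y. \<bar>h y\<bar> \<le> m) \<longrightarrow>
     (\<forall>y. \<bar>y - x\<bar> \<le> real n \<longrightarrow> \<bar>h y\<bar> \<le> 1 / real (Suc n)) \<longrightarrow>
     (\<forall>a b. 0 < a \<longrightarrow> \<bar>integral {a..b} (\<lambda>\<eta>. flux l h x \<eta> + flux l h x (- \<eta>))\<bar> \<le> e)"
proof (rule ccontr)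
  assume contra: "\<not> ?thesis"
  define Bad where "Bad = (\<lambda>n h x a b. continuous_on UNIV h \<and> (\<forall>y. \<bar>h y\<bar> \<le> m) \<and>
     (\<forall>y. \<bar>y - x\<bar> \<le> real n \<longrightarrow> \<bar>h y\<bar> \<le> 1 / real (Suc n)) \<and>
     0 < a \<and> e < \<bar>integral {a..b} (\<lambda>\<eta>. flux l h x \<eta> + flux l h x (- \<eta>))\<bar>)"
  have "\<exists>h x a b. Bad n h x a b" for n
    using contra unfolding Bad_def by (simp only: not_ex not_all not_imp not_le) blast
  then obtain h x a b where bad: "\<And>n. Bad n (h n) (x n) (a n) (b n)" by metis
  have cont: "\<And>n. continuous_on UNIV (h n)" and hm: "\<And>n y. \<bar>h n y\<bar> \<le> m"
    and small: "\<And>n y. \<bar>y - x n\<bar> \<le> real n \<Longrightarrow> \<bar>h n y\<bar> \<le> 1 / real (Suc n)"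
    and a: "\<And>n. 0 < a n" and big: "\<And>n. e < \<bar>integral {a n..b n} (\<lambda>\<eta>. flux l (h n) (x n) \<eta> + flux l (h n) (x n) (- \<eta>))\<bar>"
    using bad unfolding Bad_def by blast+
  define Q where "Q = (\<lambda>n \<eta>. flux l (h n) (x n) \<eta> + flux l (h n) (x n) (- \<eta>))"
  obtain C where "\<forall>h x \<eta>. (\<forall>y. \<bar>h y\<bar> \<le> m) \<longrightarrow> 0 < \<eta> \<longrightarrow>
    \<bar>flux l h x \<eta> + flux l h x (- \<eta>)\<bar> \<le> C * exp (- (pi / (2 * l)) * \<eta>)"
    using folded_flux_bound[OF l m] by blast
  then have C: "\<bar>Q n \<eta>\<bar> \<le> C * exp (- (pi / (2 * l)) * \<eta>)" if "0 < \<eta>" for n \<eta>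
    using that hm unfolding Q_def by blast
  have C0: "0 \<le> C"
    using order_trans[OF abs_ge_zero C[of 1]] by (simp add: zero_le_mult_iff)
  define f where "f = (\<lambda>n \<eta>. if \<eta> \<in> {a n..b n} then Q n \<eta> else 0)"
  have sub: "{a n..b n} \<subseteq> {0..}" for n using a[of n] by auto
  have ang: "\<bar>pi / (4 * l) * (h n y - h n z)\<bar> < pi / 2" "\<bar>pi / (4 * l) * (h n y + h n z)\<bar> < pi / 2" for n y z
    using hm[of n y] hm[of n z] m by (intro scaled_angle l; linarith)+
  have fint: "(f n has_integral integral {a n..b n} (Q n)) {0..}" for n
  proof -
    have "continuous_on {a n..b n} (Q n)"
      unfolding Q_def flux_def
      using a[of n] l cos_pos_of_abs[OF ang(1)] cos_pos_of_abs[OF ang(2)]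
      by (intro continuous_intros continuous_on_compose2[OF cont]) (auto simp: less_imp_neq[symmetric])
    then have "Q n integrable_on {a n..b n}" by (rule integrable_continuous_real)
    from has_integral_restrict[OF sub, THEN iffD2, OF integrable_integral[OF this]]
    show ?thesis by (simp only: f_def)
  qed
  have "(\<lambda>n. integral {0..} (f n)) \<longlonglongrightarrow> integral {0..} (\<lambda>\<eta>::real. 0::real)"
  proof (rule dominated_convergence(2)[where h = "\<lambda>\<eta>. C * exp (- (pi / (2 * l)) * \<eta>)"])
    show "f n integrable_on {0..}" for n
      using fint[of n] by (rule has_integral_integrable)
    show "(\<lambda>\<eta>. C * exp (- (pi / (2 * l)) * \<eta>)) integrable_on {0..}"
      using l by (intro exp_decay_integrable) simp
    show "norm (f n \<eta>) \<le> C * exp (- (pi / (2 * l)) * \<eta>)" if "\<eta> \<in> {0..}" for n \<eta>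
      using C[of \<eta> n] a[of n] C0 by (auto simp: f_def)
    show "(\<lambda>n. f n \<eta>) \<longlonglongrightarrow> 0" if "\<eta> \<in> {0..}" for \<eta>
    proof (rule Lim_null_comparison)
      show "\<forall>\<^sub>F n in sequentially. norm (f n \<eta>) \<le> \<bar>Q n \<eta>\<bar>" by (simp add: f_def)
      have lim: "(\<lambda>n. h n (x n - z)) \<longlonglongrightarrow> 0" for z
      proof (rule Lim_null_comparison[OF _ LIMSEQ_inverse_real_of_nat])
        obtain N where "\<bar>z\<bar> \<le> real N" using real_arch_simple by blast
        then show "\<forall>\<^sub>F n in sequentially. norm (h n (x n - z)) \<le> inverse (real (Suc n))"
          using small by (intro eventually_sequentiallyI[of N]) (force simp: inverse_eq_divide)
      qed
      have flim: "(\<lambda>n. flux l (h n) (x n) z) \<longlonglongrightarrow> 0" for z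
      proof -
        have t: "(\<lambda>n. pi / (4 * l) * (h n (x n) - h n (x n - z))) \<longlonglongrightarrow> 0"
          "(\<lambda>n. pi / (4 * l) * (h n (x n) + h n (x n - z))) \<longlonglongrightarrow> 0"
          using tendsto_diff[OF lim[of 0] lim[of z]] tendsto_add[OF lim[of 0] lim[of z]]
          by (auto intro!: tendsto_mult_right_zero simp del: times_divide_eq_left)
        have "(\<lambda>n. flux l (h n) (x n) z) \<longlonglongrightarrow> arctan (tan 0 * inverse (tanh (pi / (4 * l) * z))) +
           arctan (tan 0 * tanh (pi / (4 * l) * z))"
          unfolding flux_def divide_inverse[of "tan _"]
          by (intro tendsto_add tendsto_arctan tendsto_mult tendsto_const isCont_tendsto_compose[OF isCont_tan] t) auto
        then show ?thesis by simp
      qed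
      have "(\<lambda>n. Q n \<eta>) \<longlonglongrightarrow> 0 + 0" unfolding Q_def by (intro tendsto_add flim)
      then show "(\<lambda>n. \<bar>Q n \<eta>\<bar>) \<longlonglongrightarrow> 0" by (simp add: tendsto_rabs_zero)
    qed
  qed
  moreover have "integral {0..} (f n) = integral {a n..b n} (Q n)" for n
    using fint by (rule integral_unique)
  ultimately have "(\<lambda>n. integral {a n..b n} (Q n)) \<longlonglongrightarrow> 0" by simp
  from LIMSEQ_D[OF this e] obtain N where "norm (integral {a N..b N} (Q N)) < e" by auto
  with big[of N] show False by (simp add: Q_def)
qed

context strip_profile begin

text \<open>Near the origin the Lipschitz bound on \<open>h'\<close> compensates the singularity of \<open>Xi1\<close>, and \<open>Xi2\<close> is regular
  because \<open>m < l\<close> keeps its denominator away from 0. Far away both kernels are exponentially close to the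
  sign of \<open>\<eta>\<close>, and the remaining terms \<open>\<plusminus> 2 h'(x)\<close> cancel upon folding.\<close>

lemma folded_integrand_bound:
  assumes B1: "\<And>y. \<bar>deriv h y\<bar> \<le> B1" and B2: "\<And>y z. \<bar>deriv h y - deriv h z\<bar> \<le> B2 * \<bar>y - z\<bar>"
    and m: "\<And>y. \<bar>h y\<bar> \<le> m" "m < l"
  shows "\<exists>C. \<forall>x \<eta>. 0 < \<eta> \<longrightarrow>
    \<bar>muskat_integrand l h x \<eta> + muskat_integrand l h x (- \<eta>)\<bar> \<le> C * exp (- (pi / (2 * l)) * \<eta>)"
proof -
  define K where "K = pi / (2 * l)"
  have K: "0 < K" using l_pos by (simp add: K_def)
  have m0: "0 \<le> m" using m(1)[of 0] by linarith
  have B10: "0 \<le> B1" using B1[of 0] by linarith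
  have B20: "0 \<le> B2" using B2[of 0 1] by simp
  have Km: "K * (2 * m) < pi" using m(2) l_pos by (simp add: K_def field_simps)
  define c where "c = cos (K * (2 * m))"
  have c: "-1 < c"
    unfolding c_def using Km m0 K cos_monotone_0_pi[of "K * (2 * m)" pi] by simp
  define C1 where "C1 = B2 * (2 / K + 1) + 2 * B1 * (sinh K / (1 + c))"
  define C2 where "C2 = 4 * B1 * (4 / (1 - exp (- K))\<^sup>2)"
  have pos: "0 \<le> C1" "0 \<le> C2" using B10 B20 K c by (auto simp: C1_def C2_def)
  have X1: "Xi1 l h x \<eta> = sinh (K * \<eta>) / (cosh (K * \<eta>) - cos (K * (h x - h (x - \<eta>))))" for x \<eta>
    by (simp add: Xi1_def K_def)
  have X2: "Xi2 l h x \<eta> = sinh (K * \<eta>) / (cosh (K * \<eta>) - - cos (K * (h x + h (x - \<eta>))))" for x \<eta>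
    by (simp add: Xi2_def K_def)
  have near: "\<bar>muskat_integrand l h x \<eta>\<bar> \<le> C1" if "\<eta> \<noteq> 0" "\<bar>\<eta>\<bar> \<le> 1" for x \<eta>
  proof -
    have "\<bar>Xi1 l h x \<eta>\<bar> \<le> 2 / \<bar>K * \<eta>\<bar> + 1"
      unfolding X1 using that K by (intro coth_half_bound) auto
    then have "\<bar>(deriv h x - deriv h (x - \<eta>)) * Xi1 l h x \<eta>\<bar> \<le> (B2 * \<bar>\<eta>\<bar>) * (2 / \<bar>K * \<eta>\<bar> + 1)"
      unfolding abs_mult using B2[of x "x - \<eta>"] B20 by (intro mult_mono) auto
    also have "\<dots> = B2 * (2 / K + \<bar>\<eta>\<bar>)"
      using that K by (simp add: abs_mult field_simps)
    also have "\<dots> \<le> B2 * (2 / K + 1)"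
      using that B20 by (intro mult_left_mono) auto
    finally have 1: "\<bar>(deriv h x - deriv h (x - \<eta>)) * Xi1 l h x \<eta>\<bar> \<le> B2 * (2 / K + 1)" .
    have "\<bar>h x + h (x - \<eta>)\<bar> \<le> 2 * m" using m(1)[of x] m(1)[of "x - \<eta>"] by linarith
    then have "\<bar>K * (h x + h (x - \<eta>))\<bar> \<le> K * (2 * m)" using K by (simp add: abs_mult)
    then have "c \<le> cos \<bar>K * (h x + h (x - \<eta>))\<bar>"
      unfolding c_def using Km by (intro cos_monotone_0_pi_le) auto
    then have cc: "c \<le> cos (K * (h x + h (x - \<eta>)))" by simp
    have "\<bar>Xi2 l h x \<eta>\<bar> \<le> sinh K / (1 + c)"
    proof -
      have "\<bar>sinh (K * \<eta>)\<bar> = sinh (K * \<bar>\<eta>\<bar>)" 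
      proof (cases "\<eta> > 0")
        case False
        then have "sinh (K * \<eta>) \<le> 0" using K by (simp add: mult_le_0_iff)
        with False show ?thesis by simp
      qed (use K in simp)
      also have "\<dots> \<le> sinh K" using that K by simp
      finally have s: "\<bar>sinh (K * \<eta>)\<bar> \<le> sinh K" .
      have "1 + c \<le> cosh (K * \<eta>) - - cos (K * (h x + h (x - \<eta>)))"
        using cc cosh_real_ge_1[of "K * \<eta>"] by linarith
      then show ?thesis
        unfolding X2 abs_divide using s c K by (intro frac_le) auto
    qed
    then have 2: "\<bar>(deriv h x + deriv h (x - \<eta>)) * Xi2 l h x \<eta>\<bar> \<le> (2 * B1) * (sinh K / (1 + c))"
      unfolding abs_mult using B1[of x] B1[of "x - \<eta>"] B10 by (intro mult_mono) auto
    show ?thesis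
      unfolding muskat_integrand_def C1_def using 1 2 by linarith
  qed
  have far: "\<bar>muskat_integrand l h x \<eta> - 2 * deriv h x * sgn \<eta>\<bar> \<le> C2 * exp (- K * \<bar>\<eta>\<bar>)"
    if "1 \<le> \<bar>\<eta>\<bar>" for x \<eta>
  proof -
    define t where "t = 4 / (1 - exp (- K))\<^sup>2 * exp (- \<bar>K * \<eta>\<bar>)"
    have Ky: "K \<le> \<bar>K * \<eta>\<bar>" using that K by (simp add: abs_mult)
    have sg: "sgn (K * \<eta>) = sgn \<eta>" using K by (simp add: sgn_mult)
    have 1: "\<bar>Xi1 l h x \<eta> - sgn \<eta>\<bar> \<le> t" unfolding X1 t_def sg[symmetric] by (rule coth_half_tail[OF K Ky]) simp
    have 2: "\<bar>Xi2 l h x \<eta> - sgn \<eta>\<bar> \<le> t" unfolding X2 t_def sg[symmetric] by (rule coth_half_tail[OF K Ky]) simp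
    have "muskat_integrand l h x \<eta> - 2 * deriv h x * sgn \<eta>
       = (deriv h x - deriv h (x - \<eta>)) * (Xi1 l h x \<eta> - sgn \<eta>) + (deriv h x + deriv h (x - \<eta>)) * (Xi2 l h x \<eta> - sgn \<eta>)"
      by (simp add: muskat_integrand_def algebra_simps)
    also have "\<bar>\<dots>\<bar> \<le> 2 * B1 * t + 2 * B1 * t"
    proof (rule order_trans[OF abs_triangle_ineq], rule add_mono)
      show "\<bar>(deriv h x - deriv h (x - \<eta>)) * (Xi1 l h x \<eta> - sgn \<eta>)\<bar> \<le> 2 * B1 * t"
        unfolding abs_mult using B1[of x] B1[of "x - \<eta>"] 1 by (intro mult_mono) auto
      show "\<bar>(deriv h x + deriv h (x - \<eta>)) * (Xi2 l h x \<eta> - sgn \<eta>)\<bar> \<le> 2 * B1 * t"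
        unfolding abs_mult using B1[of x] B1[of "x - \<eta>"] 2 by (intro mult_mono) auto
    qed
    also have "\<dots> = C2 * exp (- K * \<bar>\<eta>\<bar>)" using K by (simp add: C2_def t_def abs_mult)
    finally show ?thesis .
  qed
  define C where "C = 2 * C1 * exp K + 2 * C2"
  have "\<bar>muskat_integrand l h x \<eta> + muskat_integrand l h x (- \<eta>)\<bar> \<le> C * exp (- K * \<eta>)"
    if "0 < \<eta>" for x \<eta>
  proof (cases "\<eta> \<le> 1")
    case True
    then have "\<bar>muskat_integrand l h x \<eta> + muskat_integrand l h x (- \<eta>)\<bar> \<le> 2 * C1 * 1"
      using near[of \<eta> x] near[of "- \<eta>" x] that by simp
    also have "\<dots> \<le> 2 * C1 * exp (K + - K * \<eta>)"
      using True K pos by (intro mult_left_mono) auto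
    also have "\<dots> = 2 * C1 * exp K * exp (- K * \<eta>)"
      by (simp only: exp_add mult.assoc)
    also have "\<dots> \<le> C * exp (- K * \<eta>)"
      using pos by (intro mult_right_mono) (auto simp: C_def)
    finally show ?thesis .
  next
    case False
    then have "\<bar>muskat_integrand l h x \<eta> + muskat_integrand l h x (- \<eta>)\<bar> \<le> 2 * C2 * exp (- K * \<eta>)"
      using far[of \<eta> x] far[of "- \<eta>" x] by simp
    also have "\<dots> \<le> C * exp (- K * \<eta>)"
      using pos by (intro mult_right_mono) (auto simp: C_def)
    finally show ?thesis .
  qed
  then show ?thesis unfolding K_def by blast
qed

text \<open>The conservation law in integrated form. For fixed truncation it is Fubini and the fundamental theorem
  in \<open>x\<close>; the truncation is removed by dominated convergence, using a bound that is uniform in \<open>x\<close>.\<close>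

lemma pv_integral_is_flux_difference:
  assumes B1: "\<And>y. \<bar>deriv h y\<bar> \<le> B1" and B2: "\<And>y z. \<bar>deriv h y - deriv h z\<bar> \<le> B2 * \<bar>y - z\<bar>"
    and m: "\<And>y. \<bar>h y\<bar> \<le> m" "m < l"
    and pv: "\<And>x. has_pv_integral (muskat_integrand l h x) (I x)" and ab: "a \<le> b"
  defines "Q \<equiv> \<lambda>x \<eta>. flux l h x \<eta> + flux l h x (- \<eta>)"
  shows "(\<lambda>n. (integral {inverse (real (Suc n))..real (Suc n)} (Q b) - integral {inverse (real (Suc n))..real (Suc n)} (Q a)) / (pi / (4 * l)))
      \<longlonglongrightarrow> integral {a..b} I"
proof -
  define G where "G = (\<lambda>x \<eta>. muskat_integrand l h x \<eta> + muskat_integrand l h x (- \<eta>))"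
  define J where "J = (\<lambda>n x. integral {inverse (real (Suc n))..real (Suc n)} (G x))"
  define k where "k = pi / (4 * l)"
  have k: "0 < k" using l_pos by (simp add: k_def)
  obtain C where C: "\<And>x \<eta>. 0 < \<eta> \<Longrightarrow> \<bar>G x \<eta>\<bar> \<le> C * exp (- (pi / (2 * l)) * \<eta>)"
    using folded_integrand_bound[OF B1 B2 m] unfolding G_def by blast
  have C0: "0 \<le> C"
    using order_trans[OF abs_ge_zero C[of 1]] by (simp add: zero_le_mult_iff)
  have Gcont: "continuous_on ({a..b} \<times> {\<epsilon>..R}) (\<lambda>(x, \<eta>). G x \<eta>)" if "0 < \<epsilon>" for \<epsilon> R
    unfolding G_def muskat_integrand_def Xi1_def Xi2_def split_beta
    using that denominators
    by (intro continuous_intros continuous_on_compose2[OF cont] continuous_on_compose2[OF cont_deriv])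
       (force simp: less_imp_neq[symmetric] l_pos)+
  have Jcont: "continuous_on {a..b} (J n)" for n
    unfolding J_def using Gcont[of "inverse (real (Suc n))" "real (Suc n)"]
      integral_continuous_on_param[of "{a..b}" "inverse (real (Suc n))" "real (Suc n)" G] by simp
  have exp_int: "(\<lambda>\<eta>. C * exp (- (pi / (2 * l)) * \<eta>)) integrable_on {0..}"
    using l_pos by (intro exp_decay_integrable) simp
  define D where "D = integral {0..} (\<lambda>\<eta>. C * exp (- (pi / (2 * l)) * \<eta>))"
  have Gint: "G x integrable_on {\<epsilon>..R}" if "0 < \<epsilon>" for x \<epsilon> R
  proof -
    have "continuous_on {\<epsilon>..R} (\<lambda>\<eta>. muskat_integrand l h x \<eta>)"
      using that isCont_integrand by (intro continuous_at_imp_continuous_on) auto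
    moreover have "continuous_on {\<epsilon>..R} (\<lambda>\<eta>. muskat_integrand l h x (- \<eta>))"
      using that isCont_o2[OF _ isCont_integrand, of _ uminus] by (intro continuous_at_imp_continuous_on) auto
    ultimately show ?thesis unfolding G_def by (intro integrable_continuous_real continuous_intros)
  qed
  have Jbound: "norm (J n x) \<le> D" for n x
  proof -
    have sub: "{inverse (real (Suc n))..real (Suc n)} \<subseteq> {0..}"
      using inverse_positive_iff_positive[of "real (Suc n)"] by (auto intro: order_trans[rotated] less_imp_le)
    have "norm (J n x) \<le> integral {inverse (real (Suc n))..real (Suc n)} (\<lambda>\<eta>. C * exp (- (pi / (2 * l)) * \<eta>))"
      unfolding J_def
    proof (rule integral_norm_bound_integral)
      show "G x integrable_on {inverse (real (Suc n))..real (Suc n)}" by (rule Gint) simp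
      show "(\<lambda>\<eta>. C * exp (- (pi / (2 * l)) * \<eta>)) integrable_on {inverse (real (Suc n))..real (Suc n)}"
        by (rule integrable_on_subinterval[OF exp_int sub])
      fix \<eta> assume "\<eta> \<in> {inverse (real (Suc n))..real (Suc n)}"
      then have "0 < \<eta>" by (auto intro: less_le_trans[rotated])
      then show "norm (G x \<eta>) \<le> C * exp (- (pi / (2 * l)) * \<eta>)" using C by simp
    qed
    also have "\<dots> \<le> D"
      unfolding D_def using C0
      by (intro integral_subset_le sub integrable_on_subinterval[OF exp_int sub] exp_int) auto
    finally show ?thesis .
  qed
  have swap: "integral {a..b} (J n) = (integral {inverse (real (Suc n))..real (Suc n)} (Q b) - integral {inverse (real (Suc n))..real (Suc n)} (Q a)) / k" for n
  proof -
    define \<epsilon> R where "\<epsilon> = inverse (real (Suc n))" and "R = real (Suc n)"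
    have \<epsilon>: "0 < \<epsilon>" by (simp add: \<epsilon>_def)
    have "integral {a..b} (\<lambda>x. integral {\<epsilon>..R} (G x)) = integral {\<epsilon>..R} (\<lambda>\<eta>. integral {a..b} (\<lambda>x. G x \<eta>))"
      using integral_swap_continuous[of a \<epsilon> b R G] Gcont[OF \<epsilon>] by (simp add: cbox_Pair_eq)
    also have "\<dots> = integral {\<epsilon>..R} (\<lambda>\<eta>. (Q b \<eta> - Q a \<eta>) / k)"
    proof (rule Henstock_Kurzweil_Integration.integral_cong)
      fix \<eta> assume "\<eta> \<in> {\<epsilon>..R}"
      then have \<eta>: "\<eta> \<noteq> 0" "- \<eta> \<noteq> 0" using \<epsilon> by auto
      have "((\<lambda>x. Q x \<eta> / k) has_real_derivative G x \<eta>) (at x)" for x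
        unfolding Q_def G_def
        by (rule DERIV_cong[OF DERIV_cdivide[OF DERIV_add[OF flux_derivative_position[OF \<eta>(1)] flux_derivative_position[OF \<eta>(2)]]]])
           (use k in \<open>simp add: k_def[symmetric] add_divide_distrib\<close>)
      then have "((\<lambda>x. G x \<eta>) has_integral Q b \<eta> / k - Q a \<eta> / k) {a..b}"
        using ab by (intro fundamental_theorem_of_calculus)
          (auto simp: has_real_derivative_iff_has_vector_derivative[symmetric] intro: has_field_derivative_at_within)
      then show "integral {a..b} (\<lambda>x. G x \<eta>) = (Q b \<eta> - Q a \<eta>) / k"
        by (simp add: integral_unique diff_divide_distrib)
    qed
    also have "\<dots> = (integral {\<epsilon>..R} (Q b) - integral {\<epsilon>..R} (Q a)) / k"
    proof -
      have "Q x integrable_on {\<epsilon>..R}" for x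
      proof -
        have "continuous_on {\<epsilon>..R} (Q x)"
          unfolding Q_def flux_def
          using \<epsilon> l_pos cos_pos_of_abs[OF diff_angle] cos_pos_of_abs[OF sum_angle]
          by (intro continuous_intros continuous_on_compose2[OF cont]) (auto simp: less_imp_neq[symmetric])
        then show ?thesis by (rule integrable_continuous_real)
      qed
      then show ?thesis by (simp add: Henstock_Kurzweil_Integration.integral_diff)
    qed
    finally show ?thesis by (simp add: J_def \<epsilon>_def R_def)
  qed
  have "(\<lambda>n. integral {a..b} (J n)) \<longlonglongrightarrow> integral {a..b} I"
  proof (rule dominated_convergence(2)[where h = "\<lambda>_. D"])
    show "J n integrable_on {a..b}" for n using Jcont by (rule integrable_continuous_real)
    show "norm (J n x) \<le> D" for n x by (rule Jbound)
    show "(\<lambda>n. J n x) \<longlonglongrightarrow> I x" for x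
      unfolding J_def G_def by (rule pv_integral_as_folded_limit[OF pv isCont_integrand])
  qed (rule integrable_const_ivl)
  then show ?thesis by (simp add: swap k_def)
qed

end

section \<open>The maximum of a curve of decaying functions\<close>

text \<open>A strict local minimum is the only strict minimum over \<open>S\<close> in some interval with rational endpoints.\<close>

lemma countable_strict_local_minima:
  fixes g :: "real \<Rightarrow> real"
  shows "countable {t \<in> S. \<exists>d>0. \<forall>s\<in>S. s \<noteq> t \<longrightarrow> \<bar>s - t\<bar> < d \<longrightarrow> g t < g s}"
proof -
  define A where "A = (\<lambda>(a, b). {t \<in> S. a < t \<and> t < b \<and> (\<forall>s\<in>S. s \<noteq> t \<longrightarrow> a < s \<longrightarrow> s < b \<longrightarrow> g t < g s)})"
  have "countable (A p)" for p
  proof -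
    have eq: "x = y" if "x \<in> A p" "y \<in> A p" for x y
    proof (rule ccontr)
      assume "x \<noteq> y"
      then have "g x < g y" "g y < g x" using that by (auto simp: A_def split_beta)
      then show False by simp
    qed
    show ?thesis
    proof (cases "A p = {}")
      case False
      then obtain x where "x \<in> A p" by blast
      then have "A p \<subseteq> {x}" using eq by blast
      then show ?thesis by (rule countable_subset) simp
    qed simp
  qed
  then have "countable (\<Union>p\<in>\<rat> \<times> \<rat>. A p)" by (intro countable_UN countable_SIGMA countable_rat)
  moreover have "{t \<in> S. \<exists>d>0. \<forall>s\<in>S. s \<noteq> t \<longrightarrow> \<bar>s - t\<bar> < d \<longrightarrow> g t < g s} \<subseteq> (\<Union>p\<in>\<rat> \<times> \<rat>. A p)"
  proof clarify
    fix t d assume t: "t \<in> S" "0 < d" "\<forall>s\<in>S. s \<noteq> t \<longrightarrow> \<bar>s - t\<bar> < d \<longrightarrow> g t < g s"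
    obtain a where a: "a \<in> \<rat>" "t - d < a" "a < t" using Rats_dense_in_real[of "t - d" t] t by auto
    obtain b where b: "b \<in> \<rat>" "t < b" "b < t + d" using Rats_dense_in_real[of t "t + d"] t by auto
    have "t \<in> A (a, b)" using t a b by (auto simp: A_def abs_less_iff)
    then show "t \<in> (\<Union>p\<in>\<rat> \<times> \<rat>. A p)" using a b by auto
  qed
  ultimately show ?thesis by (rule countable_subset[rotated])
qed

text \<open>A differentiable curve in the space of bounded continuous functions with values that vanish at
  infinity. A positive supremum is then attained, and only on a bounded set.\<close>

locale decaying_curve =
  fixes T :: real and u v :: "real \<Rightarrow> real \<Rightarrow>\<^sub>C real"
  assumes T_pos: "0 < T"
    and velocity: "\<And>t. t \<in> {0..T} \<Longrightarrow> (u has_vector_derivative v t) (at t within {0..T})"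
    and decay: "\<And>t. t \<in> {0..T} \<Longrightarrow> (u t \<longlongrightarrow> 0) at_infinity"
begin

definition top_value :: "real \<Rightarrow> real" where
  "top_value t = (SUP x. u t x)"

definition crest :: "real \<Rightarrow> real set" where
  "crest t = {x. \<forall>y. u t y \<le> u t x}"

lemma uniform_expansion:
  assumes "t \<in> {0..T}" "0 < e"
  obtains d where "0 < d"
    "\<And>s x. s \<in> {0..T} \<Longrightarrow> \<bar>s - t\<bar> < d \<Longrightarrow> \<bar>u s x - u t x - (s - t) * v t x\<bar> \<le> e * \<bar>s - t\<bar>"
proof -
  obtain d where d: "0 < d" "\<And>s. s \<in> {0..T} \<Longrightarrow> norm (s - t) < d \<Longrightarrow>
      norm (u s - u t - (s - t) *\<^sub>R v t) \<le> e * norm (s - t)"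
    using velocity[OF assms(1)] assms(2)
    unfolding has_vector_derivative_def has_derivative_within_alt by blast
  show thesis
  proof (rule that[OF d(1)])
    fix s x assume s: "s \<in> {0..T}" "\<bar>s - t\<bar> < d"
    have "\<bar>u s x - u t x - (s - t) * v t x\<bar> = norm ((u s - u t - (s - t) *\<^sub>R v t) x)"
      by (simp add: minus_bcontfun.rep_eq scaleR_bcontfun.rep_eq)
    also have "\<dots> \<le> norm (u s - u t - (s - t) *\<^sub>R v t)" by (rule norm_bounded)
    also have "\<dots> \<le> e * \<bar>s - t\<bar>" using d(2)[of s] s by simp
    finally show "\<bar>u s x - u t x - (s - t) * v t x\<bar> \<le> e * \<bar>s - t\<bar>" .
  qed
qed

lemma pointwise_velocity:
  assumes "t \<in> {0..T}"
  shows "((\<lambda>s. u s x) has_real_derivative v t x) (at t within {0..T})"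
  unfolding has_field_derivative_def has_derivative_within_alt
proof (intro conjI allI impI)
  fix e :: real assume "0 < e"
  from uniform_expansion[OF assms this] obtain d where "0 < d"
    "\<And>s x. s \<in> {0..T} \<Longrightarrow> \<bar>s - t\<bar> < d \<Longrightarrow> \<bar>u s x - u t x - (s - t) * v t x\<bar> \<le> e * \<bar>s - t\<bar>" by blast
  then show "\<exists>d>0. \<forall>y\<in>{0..T}. norm (y - t) < d \<longrightarrow> norm (u y x - u t x - v t x * (y - t)) \<le> e * norm (y - t)"
    by (intro exI[of _ d]) (simp add: mult.commute)
qed (rule bounded_linear_mult_right)

lemma uniformly_continuous_in_time:
  assumes "t \<in> {0..T}" "0 < e"
  obtains d where "0 < d" "\<And>s x. s \<in> {0..T} \<Longrightarrow> \<bar>s - t\<bar> < d \<Longrightarrow> \<bar>u s x - u t x\<bar> < e"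
proof -
  have "continuous (at t within {0..T}) u"
    using velocity[OF assms(1)] by (rule has_vector_derivative_continuous)
  then obtain d where d: "0 < d" "\<And>s. s \<in> {0..T} \<Longrightarrow> dist s t < d \<Longrightarrow> dist (u s) (u t) < e"
    using assms(2) unfolding continuous_within_eps_delta by blast
  show thesis
  proof (rule that[OF d(1)])
    fix s x assume s: "s \<in> {0..T}" "\<bar>s - t\<bar> < d"
    have "\<bar>u s x - u t x\<bar> = norm ((u s - u t) x)" by (simp add: minus_bcontfun.rep_eq)
    also have "\<dots> \<le> norm (u s - u t)" by (rule norm_bounded)
    also have "\<dots> < e" using d(2)[of s] s by (simp add: dist_norm)
    finally show "\<bar>u s x - u t x\<bar> < e" .
  qed
qed

lemma le_top_value: "u t x \<le> top_value t"
  unfolding top_value_def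
proof (rule cSUP_upper)
  show "bdd_above (range (apply_bcontfun (u t)))"
    using norm_bounded[of "u t"] by (intro bdd_aboveI[of _ "norm (u t)"]) (auto simp: abs_le_iff)
qed simp

lemma top_value_le: "(\<And>x. u t x \<le> c) \<Longrightarrow> top_value t \<le> c"
  unfolding top_value_def by (rule cSUP_least) auto

lemma top_value_crest: "x \<in> crest t \<Longrightarrow> u t x = top_value t"
  unfolding crest_def by (intro antisym le_top_value top_value_le) auto

lemma eventually_far:
  assumes "t \<in> {0..T}" "0 < e"
  obtains R where "\<And>x. R \<le> \<bar>x\<bar> \<Longrightarrow> \<bar>u t x\<bar> < e"
proof -
  obtain R where "\<forall>x. R \<le> norm x \<longrightarrow> dist (u t x) 0 < e"
    using tendstoD[OF decay[OF assms(1)] assms(2)] unfolding eventually_at_infinity by blast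
  then show thesis by (intro that[of R]) simp
qed

lemma top_value_nonneg: "0 \<le> top_value t" if t: "t \<in> {0..T}"
proof (rule ccontr)
  assume "\<not> 0 \<le> top_value t"
  then obtain R where R: "\<And>x. R \<le> \<bar>x\<bar> \<Longrightarrow> \<bar>u t x\<bar> < - top_value t"
    using eventually_far[OF t, of "- top_value t"] by auto
  have "\<bar>u t \<bar>R\<bar>\<bar> < - top_value t" by (rule R) simp
  then show False using le_top_value[of t "\<bar>R\<bar>"] by linarith
qed

text \<open>Outside a compact set the function is below \<open>c / 2\<close>, and on the compact part of \<open>S\<close> it attains its
  maximum. This gap is what keeps near-maximal points away from \<open>S\<close> at nearby times.\<close>

lemma gap_below_level:
  assumes t: "t \<in> {0..T}" and S: "closed S" and level: "0 < c" and below: "\<And>x. x \<in> S \<Longrightarrow> u t x < c"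
  obtains d where "0 < d" "\<And>x. x \<in> S \<Longrightarrow> u t x \<le> c - d"
proof -
  obtain R where R: "\<And>x. R \<le> \<bar>x\<bar> \<Longrightarrow> \<bar>u t x\<bar> < c / 2"
    using eventually_far[OF t, of "c / 2"] level by auto
  define K where "K = S \<inter> {-R..R}"
  have K: "compact K" unfolding K_def using S by (intro closed_Int_compact) auto
  have far: "u t x \<le> c / 2" if "x \<in> S" "x \<notin> K" for x
    using R[of x] that by (force simp: K_def)
  show thesis
  proof (cases "K = {}")
    case True
    then show thesis using that[of "c / 2"] far level by (auto simp: field_simps)
  next
    case False
    obtain x0 where x0: "x0 \<in> K" "\<And>x. x \<in> K \<Longrightarrow> u t x \<le> u t x0"
      using continuous_attains_sup[OF K False continuous_on_apply_bcontfun[of K "u t"]] by blast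
    have "u t x0 < c" using x0 below by (auto simp: K_def)
    show thesis
    proof (rule that[of "min (c / 2) (c - u t x0)"])
      show "0 < min (c / 2) (c - u t x0)" using level \<open>u t x0 < c\<close> by simp
      fix x assume "x \<in> S"
      then show "u t x \<le> c - min (c / 2) (c - u t x0)"
        using far[of x] x0(2)[of x] by (cases "x \<in> K") auto
    qed
  qed
qed

lemma crest_nonempty:
  assumes t: "t \<in> {0..T}" and pos: "0 < top_value t"
  obtains x where "x \<in> crest t"
proof -
  have "\<exists>x. u t x = top_value t"
  proof (rule ccontr)
    assume "\<nexists>x. u t x = top_value t"
    then have "u t x < top_value t" for x using le_top_value[of t x] by (metis order_le_less)
    note below = this
    show False
    proof (rule gap_below_level[OF t closed_UNIV pos])
      fix d assume "0 < d" "\<And>x. x \<in> UNIV \<Longrightarrow> u t x \<le> top_value t - d"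
      then show False using top_value_le[of t "top_value t - d"] by simp
    qed (rule below)
  qed
  then obtain x where "u t x = top_value t" by blast
  then have "x \<in> crest t" using le_top_value[of t] by (auto simp: crest_def)
  then show thesis by (rule that)
qed

lemma top_value_close:
  assumes "\<And>x. \<bar>u s x - u t x\<bar> < e"
  shows "\<bar>top_value s - top_value t\<bar> \<le> e"
proof -
  have "top_value s \<le> top_value t + e"
    using assms le_top_value[of t] by (intro top_value_le) (smt (verit))
  moreover have "top_value t \<le> top_value s + e"
    using assms le_top_value[of s] by (intro top_value_le) (smt (verit))
  ultimately show ?thesis by linarith
qed

lemma continuous_top_value: "continuous_on {0..T} top_value"
  unfolding continuous_on_iff
proof (intro ballI allI impI)
  fix t e :: real assume t: "t \<in> {0..T}" and e: "0 < e"
  then obtain d where "0 < d" "\<And>s x. s \<in> {0..T} \<Longrightarrow> \<bar>s - t\<bar> < d \<Longrightarrow> \<bar>u s x - u t x\<bar> < e / 2"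
    using uniformly_continuous_in_time[OF t, of "e / 2"] by auto
  note d = this
  show "\<exists>d>0. \<forall>s\<in>{0..T}. dist s t < d \<longrightarrow> dist (top_value s) (top_value t) < e"
  proof (intro exI[of _ d] conjI ballI impI)
    fix s assume "s \<in> {0..T}" "dist s t < d"
    then have "\<bar>top_value s - top_value t\<bar> \<le> e / 2"
      by (intro top_value_close d(2)) (auto simp: dist_real_def)
    then show "dist (top_value s) (top_value t) < e" using e by (simp add: dist_real_def)
  qed (rule d(1))
qed

text \<open>If the height were larger at \<open>t\<close> than at \<open>s\<close>, then for a small slope \<open>e\<close> the function
  \<open>top_value r - e (r - s)\<close> would attain its maximum over \<open>[s, t]\<close> at some \<open>r > s\<close>. At a crest of that time
  the curve rises at a rate of at least \<open>e\<close> from the left, against the sign of \<open>v\<close>.\<close>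

lemma top_value_antimono:
  assumes sink: "\<And>t x. t \<in> {0..T} \<Longrightarrow> x \<in> crest t \<Longrightarrow> 0 < u t x \<Longrightarrow> v t x \<le> 0"
    and st: "0 \<le> s" "s \<le> t" "t \<le> T"
  shows "top_value t \<le> top_value s"
proof (rule ccontr)
  assume less: "\<not> top_value t \<le> top_value s"
  then have "s < t" using st by (cases "s = t") auto
  \<comment> \<open>Half of the average slope, so that the tilted height is still larger at \<open>t\<close> than at \<open>s\<close>.\<close>
  define e where "e = (top_value t - top_value s) / (2 * (t - s))"
  have e: "0 < e" using less \<open>s < t\<close> by (simp add: e_def)
  define g where "g = (\<lambda>r. top_value r - e * (r - s))"
  have gt: "g s < g t" 
  proof -
    have halve: "X / (2 * w) * w = X / 2" if "w \<noteq> 0" for X w :: real using that by simp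
    have "e * (t - s) = (top_value t - top_value s) / 2"
      unfolding e_def using \<open>s < t\<close> by (intro halve) simp
    then show ?thesis using less by (simp add: g_def)
  qed
  have "continuous_on {s..t} g"
    unfolding g_def using continuous_on_subset[OF continuous_top_value, of "{s..t}"] st by (auto intro!: continuous_intros)
  then obtain r where r: "r \<in> {s..t}" "\<And>q. q \<in> {s..t} \<Longrightarrow> g q \<le> g r"
    using continuous_attains_sup[of "{s..t}" g] \<open>s < t\<close> by auto
  have rT: "r \<in> {0..T}" "s \<in> {0..T}" using r st by auto
  have "s < r" using r(1) r(2)[of t] gt \<open>s < t\<close> by (cases "r = s") auto
  have "top_value s < top_value r"
  proof -
    have "g s < g r" using r(2)[of t] gt \<open>s < t\<close> by simp
    moreover have "0 < e * (r - s)" using e \<open>s < r\<close> by simp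
    ultimately show ?thesis by (simp add: g_def)
  qed
  then have pos: "0 < top_value r" using top_value_nonneg[OF rT(2)] by linarith
  then obtain x where x: "x \<in> crest r" using crest_nonempty[OF rT(1)] by blast
  have vx: "v r x \<le> 0" using sink[OF rT(1) x] pos top_value_crest[OF x] by simp
  obtain d where d: "0 < d" "\<And>q y. q \<in> {0..T} \<Longrightarrow> \<bar>q - r\<bar> < d \<Longrightarrow> \<bar>u q y - u r y - (q - r) * v r y\<bar> \<le> e / 2 * \<bar>q - r\<bar>"
    using uniform_expansion[OF rT(1), of "e / 2"] e by auto
  define q where "q = max s (r - d / 2)"
  have q: "s \<le> q" "q < r" "\<bar>q - r\<bar> < d" "q \<in> {0..T}" "q \<in> {s..t}"
    using \<open>s < r\<close> d r(1) st by (auto simp: q_def)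
  have "0 \<le> (q - r) * v r x" using q vx by (simp add: mult_nonpos_nonpos)
  then have "u r x - e / 2 * (r - q) \<le> u q x"
  proof -
    have "\<bar>q - r\<bar> = r - q" using q by simp
    from d(2)[OF q(4,3), of x, unfolded this] \<open>0 \<le> (q - r) * v r x\<close> show ?thesis by linarith
  qed
  then have "top_value r - e / 2 * (r - q) \<le> top_value q"
    using le_top_value[of q x] top_value_crest[OF x] by linarith
  moreover have "g q \<le> g r" using r(2) q by blast
  moreover have "e * (r - s) = e * (q - s) + e * (r - q)" "e / 2 * (r - q) = (e * (r - q)) / 2"
    by (simp_all add: algebra_simps)
  moreover have "0 < e * (r - q)" using e q by simp
  ultimately show False unfolding g_def by linarith
qed

text \<open>A fixed crest at time \<open>t\<close> bounds the height from below to first order. For the upper bound, a crest at a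
  nearby time \<open>s\<close> is nearly maximal at time \<open>t\<close>; by the gap below the maximum it cannot lie in the closed
  set where the velocity differs from \<open>D\<close> by \<open>e / 2\<close>.\<close>

lemma top_value_has_derivative:
  assumes t: "t \<in> {0..T}" and pos: "0 < top_value t" and same: "\<And>x. x \<in> crest t \<Longrightarrow> v t x = D"
  shows "(top_value has_real_derivative D) (at t within {0..T})"
  unfolding has_field_derivative_def has_derivative_within_alt
proof (intro conjI allI impI)
  fix e :: real assume e: "0 < e"
  define S where "S = {x. e / 2 \<le> \<bar>v t x - D\<bar>}"
  have S: "closed S" unfolding S_def by (intro closed_Collect_le continuous_intros) auto
  have "u t x < top_value t" if "x \<in> S" for x
  proof (rule ccontr)
    assume "\<not> u t x < top_value t"
    then have "x \<in> crest t" unfolding crest_def using le_top_value[of t] by (auto simp: not_less intro: order_trans)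
    then show False using same that e by (auto simp: S_def)
  qed
  then obtain c where c: "0 < c" "\<And>x. x \<in> S \<Longrightarrow> u t x \<le> top_value t - c"
    using gap_below_level[OF t S pos] by blast
  define c' where "c' = min c (top_value t)"
  have c': "0 < c'" "c' \<le> c" "c' \<le> top_value t" using c pos by (auto simp: c'_def)
  obtain d1 where d1: "0 < d1" "\<And>s x. s \<in> {0..T} \<Longrightarrow> \<bar>s - t\<bar> < d1 \<Longrightarrow> \<bar>u s x - u t x\<bar> < c' / 3"
    using uniformly_continuous_in_time[OF t, of "c' / 3"] c' by auto
  obtain d2 where d2: "0 < d2" "\<And>s x. s \<in> {0..T} \<Longrightarrow> \<bar>s - t\<bar> < d2 \<Longrightarrow> \<bar>u s x - u t x - (s - t) * v t x\<bar> \<le> e / 2 * \<bar>s - t\<bar>"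
    using uniform_expansion[OF t, of "e / 2"] e by auto
  obtain x0 where x0: "x0 \<in> crest t" using crest_nonempty[OF t pos] by blast
  show "\<exists>d>0. \<forall>y\<in>{0..T}. norm (y - t) < d \<longrightarrow> norm (top_value y - top_value t - D * (y - t)) \<le> e * norm (y - t)"
  proof (intro exI[of _ "min d1 d2"] conjI ballI impI)
    show "0 < min d1 d2" using d1 d2 by simp
    fix s assume s: "s \<in> {0..T}" "norm (s - t) < min d1 d2"
    then have s1: "\<bar>s - t\<bar> < d1" and s2: "\<bar>s - t\<bar> < d2" by auto
    have lower: "- e * \<bar>s - t\<bar> \<le> top_value s - top_value t - D * (s - t)"
    proof -
      have "v t x0 = D" "u t x0 = top_value t" using same[OF x0] top_value_crest[OF x0] by auto
      then have "\<bar>u s x0 - top_value t - (s - t) * D\<bar> \<le> e / 2 * \<bar>s - t\<bar>"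
        using d2(2)[OF s(1) s2, of x0] by simp
      moreover have "e / 2 * \<bar>s - t\<bar> \<le> e * \<bar>s - t\<bar>" using e by (intro mult_right_mono) auto
      ultimately show ?thesis using le_top_value[of s x0]
        unfolding mult.commute[of "s - t" D] minus_mult_left[symmetric] by linarith
    qed
    have close: "\<bar>top_value s - top_value t\<bar> \<le> c' / 3" by (rule top_value_close[OF d1(2)[OF s(1) s1]])
    then have "0 < top_value s" using c' by linarith
    then obtain x where x: "x \<in> crest s" using crest_nonempty[OF s(1)] by blast
    have "x \<notin> S"
    proof
      assume "x \<in> S"
      then have "u t x \<le> top_value t - c'" using c(2) c' by force
      then show False using d1(2)[OF s(1) s1, of x] close top_value_crest[OF x] c' by linarith
    qed
    then have vx: "\<bar>v t x - D\<bar> < e / 2" by (auto simp: S_def)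
    have "(s - t) * v t x - D * (s - t) = (v t x - D) * (s - t)" by (simp add: algebra_simps)
    then have "\<bar>(s - t) * v t x - D * (s - t)\<bar> = \<bar>v t x - D\<bar> * \<bar>s - t\<bar>"
      by (simp only: abs_mult)
    also have "\<dots> \<le> e / 2 * \<bar>s - t\<bar>" using vx by (intro mult_right_mono) auto
    finally have v: "\<bar>(s - t) * v t x - D * (s - t)\<bar> \<le> e / 2 * \<bar>s - t\<bar>" .
    have upper: "top_value s - top_value t - D * (s - t) \<le> e * \<bar>s - t\<bar>"
      using d2(2)[OF s(1) s2, of x] v le_top_value[of t x] top_value_crest[OF x] by linarith
    show "norm (top_value s - top_value t - D * (s - t)) \<le> e * norm (s - t)"
      using lower upper by simp
  qed
qed (rule bounded_linear_mult_right)

text \<open>The height lies above both tangent lines at \<open>t\<close>, up to first order. If their slopes are on different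
  sides of \<open>q\<close>, the height exceeds the line of slope \<open>q\<close> on both sides of \<open>t\<close>.\<close>

lemma countable_crest_branching:
  "countable {t \<in> {0..T}. \<exists>x\<in>crest t. \<exists>y\<in>crest t. v t x < v t y}"
proof -
  define A where "A = (\<lambda>q. {t \<in> {0..T}. \<exists>d>0. \<forall>s\<in>{0..T}. s \<noteq> t \<longrightarrow> \<bar>s - t\<bar> < d \<longrightarrow> top_value t - q * t < top_value s - q * s})"
  have "countable (\<Union>q\<in>\<rat>. A q)"
    unfolding A_def by (intro countable_UN countable_rat countable_strict_local_minima)
  moreover have "{t \<in> {0..T}. \<exists>x\<in>crest t. \<exists>y\<in>crest t. v t x < v t y} \<subseteq> (\<Union>q\<in>\<rat>. A q)"
  proof clarify
    fix t x y assume t: "t \<in> {0..T}" and x: "x \<in> crest t" and y: "y \<in> crest t" and less: "v t x < v t y"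
    obtain q where q: "q \<in> \<rat>" "v t x < q" "q < v t y" using Rats_dense_in_real[OF less] by auto
    define e where "e = min (v t y - q) (q - v t x) / 2"
    have e: "0 < e" "e < v t y - q" "e < q - v t x" using q by (auto simp: e_def min_def)
    obtain d where d: "0 < d" "\<And>s x. s \<in> {0..T} \<Longrightarrow> \<bar>s - t\<bar> < d \<Longrightarrow> \<bar>u s x - u t x - (s - t) * v t x\<bar> \<le> e * \<bar>s - t\<bar>"
      using uniform_expansion[OF t e(1)] by blast
    have "top_value t - q * t < top_value s - q * s" if s: "s \<in> {0..T}" "s \<noteq> t" "\<bar>s - t\<bar> < d" for s
    proof (cases "t < s")
      case True
      have "top_value t + (s - t) * v t y - e * (s - t) \<le> top_value s"
        using d(2)[OF s(1,3), of y] le_top_value[of s y] top_value_crest[OF y] True by simp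
      moreover have "0 < (s - t) * (v t y - q - e)" using True e by simp
      ultimately show ?thesis by (simp add: algebra_simps)
    next
      case False
      then have st: "s < t" using s by simp
      have "top_value t + (s - t) * v t x - e * (t - s) \<le> top_value s"
        using d(2)[OF s(1,3), of x] le_top_value[of s x] top_value_crest[OF x] st by simp
      moreover have "0 < (t - s) * (q - v t x - e)" using st e by simp
      ultimately show ?thesis by (simp add: algebra_simps)
    qed
    then have "t \<in> A q" using t d(1) by (auto simp: A_def)
    then show "t \<in> (\<Union>q\<in>\<rat>. A q)" using q by blast
  qed
  ultimately show ?thesis by (rule countable_subset[rotated])
qed

text \<open>By compactness of the time interval finitely many times suffice.\<close>

lemma uniform_decay:
  assumes "0 < e"
  obtains R where "\<And>t x. t \<in> {0..T} \<Longrightarrow> R \<le> \<bar>x\<bar> \<Longrightarrow> \<bar>u t x\<bar> < e"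
proof -
  define close where "close = (\<lambda>t d. 0 < d \<and> (\<forall>s\<in>{0..T}. \<forall>x. \<bar>s - t\<bar> < d \<longrightarrow> \<bar>u s x - u t x\<bar> < e / 2))"
  have "\<exists>d. close t d" if t: "t \<in> {0..T}" for t
  proof (rule uniformly_continuous_in_time[OF t half_gt_zero[OF assms]])
    fix d assume "0 < d" "\<And>s x. s \<in> {0..T} \<Longrightarrow> \<bar>s - t\<bar> < d \<Longrightarrow> \<bar>u s x - u t x\<bar> < e / 2"
    then show ?thesis unfolding close_def by blast
  qed
  then obtain d where "\<And>t. t \<in> {0..T} \<Longrightarrow> close t (d t)" by metis
  then have d: "\<And>t. t \<in> {0..T} \<Longrightarrow> 0 < d t"
    "\<And>t s x. t \<in> {0..T} \<Longrightarrow> s \<in> {0..T} \<Longrightarrow> \<bar>s - t\<bar> < d t \<Longrightarrow> \<bar>u s x - u t x\<bar> < e / 2"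
    unfolding close_def by blast+
  have "{0..T} \<subseteq> (\<Union>t\<in>{0..T}. ball t (d t))" using d(1) by auto
  then obtain C where C: "C \<subseteq> {0..T}" "finite C" "{0..T} \<subseteq> (\<Union>t\<in>C. ball t (d t))"
    using compactE_image[OF compact_Icc, of "{0..T}" "\<lambda>t. ball t (d t)"] by blast
  have "\<forall>\<^sub>F x in at_infinity. \<forall>t\<in>C. \<bar>u t x\<bar> < e / 2"
    using C assms tendstoD[OF decay, of _ "e / 2"] by (intro eventually_ball_finite) auto
  then obtain R where R: "\<And>x t. R \<le> \<bar>x\<bar> \<Longrightarrow> t \<in> C \<Longrightarrow> \<bar>u t x\<bar> < e / 2"
    unfolding eventually_at_infinity by auto
  show thesis
  proof (rule that)
    fix t x assume t: "t \<in> {0..T}" and x: "R \<le> \<bar>x\<bar>"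
    then obtain c where c: "c \<in> C" "\<bar>t - c\<bar> < d c" using C(3) by (auto simp: dist_real_def abs_minus_commute)
    then have "\<bar>u t x - u c x\<bar> < e / 2" using d(2)[of c t x] C(1) t by auto
    then show "\<bar>u t x\<bar> < e" using R[OF x c(1)] by linarith
  qed
qed

lemma integral_change_le:
  assumes ab: "a \<le> b" and bnd: "\<And>t. t \<in> {0..T} \<Longrightarrow> \<bar>integral {a..b} (v t)\<bar> \<le> B" and t: "t \<in> {0..T}"
  shows "\<bar>integral {a..b} (u t) - integral {a..b} (u 0)\<bar> \<le> B * t"
proof -
  have int: "apply_bcontfun w integrable_on {a..b}" for w :: "real \<Rightarrow>\<^sub>C real"
    by (intro integrable_continuous_real continuous_on_apply_bcontfun)
  have lin: "bounded_linear (\<lambda>w :: real \<Rightarrow>\<^sub>C real. integral {a..b} (apply_bcontfun w))"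
  proof (rule bounded_linear_intro[where K = "b - a"])
    fix w :: "real \<Rightarrow>\<^sub>C real"
    have "norm (integral {a..b} (apply_bcontfun w)) \<le> norm w * (b - a)"
      using ab norm_bounded[of w] by (intro integral_bound continuous_on_apply_bcontfun) auto
    then show "norm (integral {a..b} (apply_bcontfun w)) \<le> norm w * (b - a)" .
  qed (simp_all add: plus_bcontfun.rep_eq scaleR_bcontfun.rep_eq int Henstock_Kurzweil_Integration.integral_add)
  have "norm (integral {a..b} (u t) - integral {a..b} (u 0)) \<le> B * norm (t - 0)"
  proof (rule field_differentiable_bound[where S = "{0..T}" and f' = "\<lambda>t. integral {a..b} (v t)"])
    fix s assume s: "s \<in> {0..T}"
    show "((\<lambda>t. integral {a..b} (u t)) has_real_derivative integral {a..b} (v s)) (at s within {0..T})"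
      unfolding has_real_derivative_iff_has_vector_derivative
      using bounded_linear.has_vector_derivative[OF lin velocity[OF s]] by simp
    show "norm (integral {a..b} (v s)) \<le> B" using bnd[OF s] by simp
  qed (use t T_pos in auto)
  then show ?thesis using t by simp
qed

end

section \<open>Nonnegative solutions of the Muskat equation\<close>

lemma Linf_norm_attained:
  assumes "continuous_on UNIV h" "\<And>y. \<bar>h y\<bar> \<le> c" "\<bar>h x\<bar> = c"
  shows "Linf_norm h = ereal c"
  unfolding Linf_norm_eq_SUP[OF assms(1)]
proof (rule antisym)
  show "(SUP x. ereal \<bar>h x\<bar>) \<le> ereal c" using assms(2) by (intro SUP_least) simp
  show "ereal c \<le> (SUP x. ereal \<bar>h x\<bar>)" using SUP_upper[of x UNIV "\<lambda>x. ereal \<bar>h x\<bar>"] assms(3) by simp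
qed

lemma integral_pos_around:
  fixes h :: "real \<Rightarrow> real"
  assumes h: "continuous_on UNIV h" "\<And>x. 0 \<le> h x" "h x \<noteq> 0"
  shows "0 < integral {x - 1..x + 1} h"
proof -
  have cont: "continuous_on {x - 1..x + 1} h" using h(1) by (rule continuous_on_subset) simp
  then have int: "h integrable_on {x - 1..x + 1}" by (rule integrable_continuous_real)
  have "integral {x - 1..x + 1} h \<noteq> 0"
  proof
    assume "integral {x - 1..x + 1} h = 0"
    then have "(h has_integral 0) (cbox (x - 1) (x + 1))"
      using integrable_integral[OF int] by simp
    from has_integral_0_cbox_imp_0[OF _ _ this, of x] h cont show False by auto
  qed
  moreover have "0 \<le> integral {x - 1..x + 1} h" using h(2) by (intro integral_nonneg int) auto
  ultimately show ?thesis by simp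
qed

lemma has_pv_integral_uminus:
  assumes "has_pv_integral g I"
  shows "has_pv_integral (\<lambda>\<eta>. - g \<eta>) (- I)"
proof -
  have "((\<lambda>p. - (case p of (\<epsilon>, R) \<Rightarrow> LINT \<eta>:{\<eta>. \<epsilon> \<le> \<bar>\<eta>\<bar> \<and> \<bar>\<eta>\<bar> \<le> R}|lborel. g \<eta>)) \<longlongrightarrow> - I)
      (at_right 0 \<times>\<^sub>F at_top)"
    using assms unfolding has_pv_integral_def by (intro tendsto_minus) blast
  moreover have "(\<lambda>p. - (case p of (\<epsilon>, R) \<Rightarrow> LINT \<eta>:{\<eta>. \<epsilon> \<le> \<bar>\<eta>\<bar> \<and> \<bar>\<eta>\<bar> \<le> R}|lborel. g \<eta>))
      = (\<lambda>(\<epsilon>, R). LINT \<eta>:{\<eta>. \<epsilon> \<le> \<bar>\<eta>\<bar> \<and> \<bar>\<eta>\<bar> \<le> R}|lborel. - g \<eta>)"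
    by (simp add: fun_eq_iff split_beta set_lebesgue_integral_def)
  ultimately show ?thesis
    using assms unfolding has_pv_integral_def by (auto simp: set_integrable_def)
qed

context strip_profile begin

lemma pv_integral_nonpos_at_maximum:
  assumes "has_pv_integral (muskat_integrand l h x) I" "\<And>y. h y \<le> h x"
  shows "I \<le> 0"
  using pv_integral_at_maximum[OF assms, of 1 1] by simp

lemma deriv_uminus: "deriv (\<lambda>x. - h x) = (\<lambda>x. - deriv h x)"
  using DERIV_imp_deriv[OF DERIV_minus[OF deriv]] by blast

lemma reflected: "strip_profile l (\<lambda>x. - h x)"
proof
  show "((\<lambda>x. - h x) has_real_derivative deriv (\<lambda>x. - h x) y) (at y)" for y
    unfolding deriv_uminus by (rule DERIV_minus[OF deriv])
  show "continuous_on UNIV (deriv (\<lambda>x. - h x))"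
    unfolding deriv_uminus using cont_deriv by (rule continuous_on_minus)
  show "((\<lambda>x. - h x) \<longlongrightarrow> 0) at_infinity" using tendsto_minus[OF decay] by simp
qed (use l_pos bound in auto)

lemma integrand_reflected: "muskat_integrand l (\<lambda>x. - h x) x = (\<lambda>\<eta>. - muskat_integrand l h x \<eta>)"
proof
  fix \<eta>
  have arg: "c * (- a - - b) = - (c * (a - b))" "c * (- a + - b) = - (c * (a + b))" for a b c :: real
    by (simp_all add: algebra_simps)
  have "(- a - - b) * X + (- a + - b) * Y = - ((a - b) * X + (a + b) * Y)" for a b X Y :: real
    by (simp add: algebra_simps)
  then show "muskat_integrand l (\<lambda>x. - h x) x \<eta> = - muskat_integrand l h x \<eta>"
    unfolding muskat_integrand_def Xi1_def Xi2_def deriv_uminus arg cos_minus .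
qed

lemma pv_integral_nonneg_at_minimum:
  assumes pv: "has_pv_integral (muskat_integrand l h x) I" and min: "\<And>y. h x \<le> h y"
  shows "0 \<le> I"
proof -
  interpret r: strip_profile l "\<lambda>x. - h x" by (rule reflected)
  have "has_pv_integral (muskat_integrand l (\<lambda>x. - h x) x) (- I)"
    unfolding integrand_reflected by (rule has_pv_integral_uminus[OF pv])
  from r.pv_integral_nonpos_at_maximum[OF this] min show ?thesis by simp
qed

end

text \<open>What the proof uses of a classical solution. The curve takes values in the space of bounded continuous
  functions, and the velocity is expressed through the principal value, with \<open>\<kappa> = (\<rho>2 - \<rho>1) / (8 l)\<close>.\<close>

locale muskat_flow = decaying_curve +
  fixes l \<kappa> :: real
  assumes \<kappa>_pos: "0 < \<kappa>"
    and profile: "\<And>t. t \<in> {0..T} \<Longrightarrow> strip_profile l (u t)"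
    and amplitude: "\<And>t. t \<in> {0..T} \<Longrightarrow> \<exists>m<l. \<forall>y. \<bar>u t y\<bar> \<le> m"
    and slope_bound: "\<And>t. t \<in> {0..T} \<Longrightarrow> \<exists>B. \<forall>y. \<bar>deriv (u t) y\<bar> \<le> B"
    and slope_Lipschitz: "\<And>t. t \<in> {0..T} \<Longrightarrow> \<exists>B. \<forall>y z. \<bar>deriv (u t) y - deriv (u t) z\<bar> \<le> B * \<bar>y - z\<bar>"
    and law: "\<And>t x. t \<in> {0..T} \<Longrightarrow> has_pv_integral (muskat_integrand l (u t) x) (v t x / \<kappa>)"
    and initially_nonneg: "\<And>x. 0 \<le> u 0 x"
begin

lemma l_pos: "0 < l"
  using profile[of 0] T_pos by (simp add: strip_profile_def)

lemma max_height_antimono: "0 \<le> s \<Longrightarrow> s \<le> t \<Longrightarrow> t \<le> T \<Longrightarrow> top_value t \<le> top_value s"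
proof (rule top_value_antimono)
  fix t x assume t: "t \<in> {0..T}" and x: "x \<in> crest t" "0 < u t x"
  have "v t x / \<kappa> \<le> 0"
    using x by (intro strip_profile.pv_integral_nonpos_at_maximum[OF profile[OF t] law[OF t]]) (auto simp: crest_def)
  then show "v t x \<le> 0" using \<kappa>_pos by (simp add: divide_le_0_iff)
qed

text \<open>The maximum principle for the reflected curve: the height of \<open>- u\<close> starts at a value \<open>\<le> 0\<close> and does
  not increase.\<close>

lemma stays_nonneg: "0 \<le> u t x" if t: "t \<in> {0..T}"
proof -
  interpret neg: decaying_curve T "\<lambda>t. - u t" "\<lambda>t. - v t"
  proof
    fix t assume t: "t \<in> {0..T}"
    show "((\<lambda>t. - u t) has_vector_derivative - v t) (at t within {0..T})"
      by (rule has_vector_derivative_minus[OF velocity[OF t]])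
    show "(apply_bcontfun (- u t) \<longlongrightarrow> 0) at_infinity"
      using tendsto_minus[OF decay[OF t]] by (simp add: uminus_bcontfun.rep_eq)
  qed (rule T_pos)
  have "- u t x \<le> neg.top_value t"
    using neg.le_top_value[of t x] by (simp add: uminus_bcontfun.rep_eq)
  also have "\<dots> \<le> neg.top_value 0"
  proof (rule neg.top_value_antimono)
    fix t x assume t: "t \<in> {0..T}" and x: "x \<in> neg.crest t" "0 < (- u t) x"
    have "0 \<le> v t x / \<kappa>"
      using x by (intro strip_profile.pv_integral_nonneg_at_minimum[OF profile[OF t] law[OF t]])
        (auto simp: neg.crest_def uminus_bcontfun.rep_eq)
    then show "(- v t) x \<le> 0" using \<kappa>_pos by (simp add: uminus_bcontfun.rep_eq zero_le_divide_iff)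
  qed (use t in auto)
  also have "\<dots> \<le> 0" using initially_nonneg by (intro neg.top_value_le) (simp add: uminus_bcontfun.rep_eq)
  finally show ?thesis by simp
qed

lemma initial_height_less: "top_value 0 < l"
proof -
  obtain m where "m < l" "\<forall>y. \<bar>u 0 y\<bar> \<le> m" using amplitude[of 0] T_pos by auto
  then show ?thesis using top_value_le[of 0 m] by (force simp: abs_le_iff)
qed

lemma height_bound: "\<bar>u t x\<bar> \<le> top_value 0" if t: "t \<in> {0..T}"
  using stays_nonneg[OF t, of x] le_top_value[of t x] max_height_antimono[of 0 t] t by simp

text \<open>The mass in \<open>[- b, b]\<close> changes at a rate given by the fluxes at \<open>b\<close> and \<open>- b\<close>. They are small for all
  large \<open>b\<close>, uniformly in time, because the solution decays uniformly and its amplitude does not grow.\<close>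

lemma mass_nearly_constant:
  assumes e: "0 < e"
  obtains R where "\<And>t b. t \<in> {0..T} \<Longrightarrow> R \<le> b \<Longrightarrow> \<bar>integral {-b..b} (u t) - integral {-b..b} (u 0)\<bar> \<le> e"
proof -
  define k where "k = pi / (4 * l)"
  have k: "0 < k" using l_pos by (simp add: k_def)
  \<comment> \<open>The two fluxes, divided by \<open>k\<close>, multiplied by \<open>\<kappa>\<close> and integrated over time, must add up to at most \<open>e\<close>.\<close>
  define e' where "e' = e * k / (2 * \<kappa> * T)"
  have e': "0 < e'" using e k \<kappa>_pos T_pos by (simp add: e'_def)
  obtain n where n: "\<forall>h x. continuous_on UNIV h \<longrightarrow> (\<forall>y. \<bar>h y\<bar> \<le> top_value 0) \<longrightarrow>
     (\<forall>y. \<bar>y - x\<bar> \<le> real n \<longrightarrow> \<bar>h y\<bar> \<le> 1 / real (Suc n)) \<longrightarrow>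
     (\<forall>a b. 0 < a \<longrightarrow> \<bar>integral {a..b} (\<lambda>\<eta>. flux l h x \<eta> + flux l h x (- \<eta>))\<bar> \<le> e')"
    using integral_folded_flux_small[OF l_pos _ initial_height_less e'] top_value_nonneg[of 0] T_pos by auto
  obtain R where R: "\<And>t x. t \<in> {0..T} \<Longrightarrow> R \<le> \<bar>x\<bar> \<Longrightarrow> \<bar>u t x\<bar> < 1 / real (Suc n)"
    using uniform_decay[of "1 / real (Suc n)"] by auto
  show thesis
  proof (rule that)
    fix t b assume t: "t \<in> {0..T}" and b: "\<bar>R\<bar> + real n \<le> b"
    have small: "\<bar>integral {a..c} (\<lambda>\<eta>. flux l (u s) x \<eta> + flux l (u s) x (- \<eta>))\<bar> \<le> e'"
      if s: "s \<in> {0..T}" and x: "\<bar>x\<bar> = b" and a: "0 < a" for s x a c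
    proof (rule n[rule_format])
      show "\<bar>u s y\<bar> \<le> 1 / real (Suc n)" if "\<bar>y - x\<bar> \<le> real n" for y
        using R[OF s, of y] that x b by linarith
    qed (use height_bound[OF s] a in auto)
    have v: "\<bar>integral {-b..b} (v s)\<bar> \<le> e / T" if s: "s \<in> {0..T}" for s
    proof -
      interpret h: strip_profile l "u s" by (rule profile[OF s])
      obtain B1 where B1: "\<And>y. \<bar>deriv (u s) y\<bar> \<le> B1" using slope_bound[OF s] by blast
      obtain B2 where B2: "\<And>y z. \<bar>deriv (u s) y - deriv (u s) z\<bar> \<le> B2 * \<bar>y - z\<bar>" using slope_Lipschitz[OF s] by blast
      define Q where "Q = (\<lambda>x n. integral {inverse (real (Suc n))..real (Suc n)} (\<lambda>\<eta>. flux l (u s) x \<eta> + flux l (u s) x (- \<eta>)))"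
      have "(\<lambda>n. (Q b n - Q (- b) n) / k) \<longlonglongrightarrow> integral {-b..b} (\<lambda>x. v s x / \<kappa>)"
        unfolding Q_def k_def
        using b by (intro h.pv_integral_is_flux_difference[OF B1 B2 height_bound[OF s] initial_height_less law[OF s]]) auto
      then have lim: "(\<lambda>n. \<bar>(Q b n - Q (- b) n) / k\<bar>) \<longlonglongrightarrow> \<bar>integral {-b..b} (\<lambda>x. v s x / \<kappa>)\<bar>"
        by (rule tendsto_rabs)
      have "\<bar>(Q b n - Q (- b) n) / k\<bar> \<le> 2 * e' / k" for n
      proof -
        have "\<bar>Q b n\<bar> \<le> e'" "\<bar>Q (- b) n\<bar> \<le> e'"
          unfolding Q_def using b by (intro small s; simp)+
        then have "\<bar>Q b n - Q (- b) n\<bar> \<le> 2 * e'" by linarith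
        then show ?thesis using k by (simp add: divide_right_mono)
      qed
      then have "\<bar>integral {-b..b} (\<lambda>x. v s x / \<kappa>)\<bar> \<le> 2 * e' / k"
        by (intro tendsto_upperbound[OF lim]) auto
      then have "\<bar>integral {-b..b} (v s)\<bar> / \<kappa> \<le> 2 * e' / k" using \<kappa>_pos by simp
      also have "2 * e' / k = e / T / \<kappa>" using k \<kappa>_pos T_pos by (simp add: e'_def)
      finally have "\<bar>integral {-b..b} (v s)\<bar> / \<kappa> \<le> e / T / \<kappa>" .
      from this[unfolded divide_le_cancel] \<kappa>_pos show ?thesis by simp
    qed
    have "- b \<le> b" using b by linarith
    then have "\<bar>integral {-b..b} (u t) - integral {-b..b} (u 0)\<bar> \<le> e / T * t"
      by (rule integral_change_le[OF _ v t])
    also have "\<dots> \<le> e / T * T" using t e T_pos by (intro mult_left_mono) auto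
    also have "\<dots> = e" using T_pos by simp
    finally show "\<bar>integral {-b..b} (u t) - integral {-b..b} (u 0)\<bar> \<le> e" .
  qed
qed

lemma integrable_on_interval: "u t integrable_on {a..b}" for a b :: real
  by (intro integrable_continuous_real continuous_on_apply_bcontfun)

lemma local_mass_le:
  assumes A: "\<And>a b. integral {a..b} (u 0) \<le> A" and t: "t \<in> {0..T}"
  shows "integral {a..b} (u t) \<le> A"
proof (rule field_le_epsilon)
  fix e :: real assume e: "0 < e"
  obtain R where R: "\<And>t b. t \<in> {0..T} \<Longrightarrow> R \<le> b \<Longrightarrow> \<bar>integral {-b..b} (u t) - integral {-b..b} (u 0)\<bar> \<le> e"
    using mass_nearly_constant[OF e] by blast
  define c where "c = max R (max \<bar>a\<bar> \<bar>b\<bar>)"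
  have "integral {a..b} (u t) \<le> integral {-c..c} (u t)"
    by (intro integral_subset_le integrable_on_interval) (auto simp: c_def intro: stays_nonneg[OF t])
  also have "\<dots> \<le> A + e"
  proof -
    have "R \<le> c" by (simp add: c_def)
    from R[OF t this] A[of "-c" c] show ?thesis by linarith
  qed
  finally show "integral {a..b} (u t) \<le> A + e" .
qed

text \<open>A flat solution would have lost the mass that is initially present around \<open>x0\<close>.\<close>

lemma never_flat:
  assumes "u 0 x0 \<noteq> 0" and t: "t \<in> {0..T}"
  shows "0 < top_value t"
proof (rule ccontr)
  assume "\<not> 0 < top_value t"
  then have flat: "u t x = 0" for x using stays_nonneg[OF t, of x] le_top_value[of t x] by linarith
  define a where "a = integral {x0 - 1..x0 + 1} (u 0)"
  have "0 < a"
    unfolding a_def using initially_nonneg assms(1) by (intro integral_pos_around continuous_on_apply_bcontfun)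
  then have a: "0 < a / 2" by simp
  obtain R where R: "\<And>t b. t \<in> {0..T} \<Longrightarrow> R \<le> b \<Longrightarrow> \<bar>integral {-b..b} (u t) - integral {-b..b} (u 0)\<bar> \<le> a / 2"
    using mass_nearly_constant[OF a] by blast
  define c where "c = max R (\<bar>x0\<bar> + 1)"
  have "a \<le> integral {-c..c} (u 0)"
    unfolding a_def by (intro integral_subset_le integrable_on_interval) (auto simp: c_def intro: initially_nonneg)
  moreover have "\<bar>0 - integral {-c..c} (u 0)\<bar> \<le> a / 2"
  proof -
    have "R \<le> c" by (simp add: c_def)
    moreover have "integral {-c..c} (u t) = integral {-c..c} (\<lambda>_. 0 :: real)"
      using flat by (intro Henstock_Kurzweil_Integration.integral_cong) simp
    ultimately show ?thesis using R[OF t, of c] by (simp only: Henstock_Kurzweil_Integration.integral_0)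
  qed
  ultimately show False using a by linarith
qed

text \<open>The window of integration reaches so far that the mass \<open>A\<close> cannot fill it up to the level of the
  crest: \<open>R\<close> is chosen such that \<open>2 M (R - 1) - A = M\<close>. The price is the factor \<open>exp (- K R)\<close> in the
  lower bound for the drift.\<close>

lemma crest_sinks:
  assumes A: "\<And>a b. integral {a..b} (u 0) \<le> A" and t: "t \<in> {0..T}" and x: "x \<in> crest t" and M: "0 < top_value t"
  defines "K \<equiv> pi / (2 * l)"
  shows "v t x \<le> - (\<kappa> * ((cos (K * top_value 0))\<^sup>2 * (1 - sin (K * top_value 0)) / 8 * K) * exp (- (3 / 2 * K)) * (K * A))
      * exp (- (pi * A) / (l * top_value t))"
proof -
  interpret h: strip_profile l "u t" by (rule profile[OF t])
  define M where "M = top_value t"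
  define F0 where "F0 = K * top_value 0"
  define R where "R = 3 / 2 + A / (2 * M)"
  define q where "q = (cos F0)\<^sup>2 * (1 - sin F0) / 8 * K"
  have M0: "0 < M" using assms by (simp add: M_def)
  have A0: "0 \<le> A" using A[of 1 0] by simp
  have K: "0 < K" using l_pos by (simp add: K_def)
  have "0 \<le> A / (2 * M)" using A0 M0 by simp
  then have R: "1 \<le> R" by (simp add: R_def)
  have ux: "u t x = M" using top_value_crest[OF x] by (simp add: M_def)
  have top: "u t y \<le> M" for y using le_top_value by (simp add: M_def)
  have q0: "0 \<le> q" using K by (simp add: q_def)
  define p where "p = (\<lambda>\<eta>. drift (cosh (K * \<eta>)) (K * u t x) (K * (u t x - u t (x - \<eta>))))"
  have max: "u t y \<le> u t x" for y using x by (simp add: crest_def)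
  have low: "q * exp (- K * R) * (M - u t (x - \<eta>)) \<le> p \<eta>" if \<eta>: "1 \<le> \<bar>\<eta>\<bar>" "\<bar>\<eta>\<bar> \<le> R" for \<eta>
  proof -
    have F: "0 \<le> K * M" "K * M \<le> F0" "F0 < pi / 2"
    proof -
      show "0 \<le> K * M" using K M0 by simp
      show "K * M \<le> F0" unfolding F0_def M_def using K max_height_antimono[of 0 t] t by (intro mult_left_mono) auto
      show "F0 < pi / 2" unfolding F0_def K_def using initial_height_less l_pos by (simp add: field_simps)
    qed
    have \<beta>: "0 \<le> K * (M - u t (x - \<eta>))" "K * (M - u t (x - \<eta>)) \<le> K * M"
      using K top[of "x - \<eta>"] stays_nonneg[OF t, of "x - \<eta>"] by auto
    have C: "1 < cosh (K * \<eta>)" using K \<eta> by (intro cosh_gt_1) auto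
    have "cosh (K * \<eta>) \<le> exp (K * R)"
    proof -
      have "cosh (K * \<eta>) = cosh (K * \<bar>\<eta>\<bar>)" using K by (simp add: cosh_real_abs[of "K * \<eta>", symmetric] abs_mult)
      also have "\<dots> \<le> cosh (K * R)" using K \<eta> by (subst cosh_real_nonneg_le_iff) auto
      also have "\<dots> \<le> exp (K * R)" using K R by (simp add: cosh_def)
      finally show ?thesis .
    qed
    have "q * exp (- K * R) * (M - u t (x - \<eta>)) = (cos F0)\<^sup>2 * (1 - sin F0) / 8 * (K * (M - u t (x - \<eta>))) / exp (K * R)"
      by (simp add: q_def exp_minus field_simps)
    also have "\<dots> \<le> (cos F0)\<^sup>2 * (1 - sin F0) / 8 * (K * (M - u t (x - \<eta>))) / cosh (K * \<eta>)"
      using \<beta> C \<open>cosh (K * \<eta>) \<le> exp (K * R)\<close> by (intro divide_left_mono mult_nonneg_nonneg[OF _ \<beta>(1)]) auto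
    also have "\<dots> \<le> p \<eta>"
      unfolding p_def ux by (rule drift_lower_bound[OF C F \<beta>])
    finally show ?thesis .
  qed
  define g where "g = (\<lambda>\<eta>. q * exp (- K * R) * (2 * M - u t (x - \<eta>) - u t (x + \<eta>)))"
  have "q * exp (- K * R) * M \<le> integral {1..R} g"
  proof -
    have left: "((\<lambda>\<eta>. u t (x - \<eta>)) has_integral integral {x - R..x - 1} (u t)) {1..R}"
      using has_integral_affinity[OF integrable_integral[OF integrable_on_interval[of t "x - R" "x - 1"], folded cbox_interval], of "-1" x]
      by simp
    have right: "((\<lambda>\<eta>. u t (x + \<eta>)) has_integral integral {x + 1..x + R} (u t)) {1..R}"
      using has_integral_affinity[OF integrable_integral[OF integrable_on_interval[of t "x + 1" "x + R"], folded cbox_interval], of 1 x]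
      by (simp add: add.commute)
    have mass: "integral {x - R..x - 1} (u t) + integral {x + 1..x + R} (u t) \<le> A"
    proof -
      have "integral {x - R..x + R} (u t) = integral {x - R..x - 1} (u t) + integral {x - 1..x + 1} (u t) + integral {x + 1..x + R} (u t)"
        using R Henstock_Kurzweil_Integration.integral_combine[of "x - R" "x - 1" "x + R" "u t"]
          Henstock_Kurzweil_Integration.integral_combine[of "x - 1" "x + 1" "x + R" "u t"] integrable_on_interval by simp
      moreover have "0 \<le> integral {x - 1..x + 1} (u t)"
        using stays_nonneg[OF t] by (intro integral_nonneg integrable_on_interval) auto
      moreover have "integral {x - R..x + R} (u t) \<le> A" by (rule local_mass_le[OF A t])
      ultimately show ?thesis by linarith
    qed
    have const: "((\<lambda>\<eta>. 2 * M) has_integral 2 * M * (R - 1)) {1..R}"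
      using has_integral_const_real[of "2 * M" 1 R] R by (simp add: mult.commute)
    have "(g has_integral q * exp (- K * R) * (2 * M * (R - 1) - integral {x - R..x - 1} (u t) - integral {x + 1..x + R} (u t))) {1..R}"
      unfolding g_def by (intro has_integral_mult_right has_integral_diff const left right)
    then have "integral {1..R} g = q * exp (- K * R) * (2 * M * (R - 1) - integral {x - R..x - 1} (u t) - integral {x + 1..x + R} (u t))"
      by (rule integral_unique)
    also have "\<dots> \<ge> q * exp (- K * R) * M"
    proof (intro mult_left_mono mult_nonneg_nonneg q0)
      have "2 * M * (R - 1) = M + A" using M0 by (simp add: R_def field_simps)
      then show "M \<le> 2 * M * (R - 1) - integral {x - R..x - 1} (u t) - integral {x + 1..x + R} (u t)" using mass by linarith
    qed simp
    finally show ?thesis .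
  qed
  also have "integral {1..R} g \<le> integral {1..R} (\<lambda>\<eta>. p \<eta> + p (- \<eta>))"
  proof (rule integral_le)
    show "g integrable_on {1..R}"
      unfolding g_def by (intro integrable_continuous_real continuous_intros continuous_on_compose2[OF h.cont]) auto
    have cont_p: "isCont p \<eta>" if "\<eta> \<noteq> 0" for \<eta>
      unfolding p_def K_def by (rule h.isCont_drift[OF that])
    have "continuous_on {1..R} (\<lambda>\<eta>. p \<eta> + p (- \<eta>))"
      using cont_p isCont_o2[of _ uminus p]
      by (intro continuous_at_imp_continuous_on ballI continuous_intros) auto
    then show "(\<lambda>\<eta>. p \<eta> + p (- \<eta>)) integrable_on {1..R}" by (rule integrable_continuous_real)
    fix \<eta> assume "\<eta> \<in> {1..R}"
    then show "g \<eta> \<le> p \<eta> + p (- \<eta>)"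
      using low[of \<eta>] low[of "- \<eta>"] by (simp add: g_def algebra_simps)
  qed
  also have "\<dots> \<le> - (v t x / \<kappa>)"
  proof -
    have "v t x / \<kappa> \<le> - integral {1..R} (\<lambda>\<eta>. p \<eta> + p (- \<eta>))"
      unfolding p_def K_def by (rule h.pv_integral_at_maximum[OF law[OF t] max]) (use R in auto)
    then show ?thesis by linarith
  qed
  finally have "v t x \<le> - \<kappa> * (q * exp (- K * R) * M)"
    using \<kappa>_pos by (simp add: field_simps)
  also have "\<dots> \<le> - \<kappa> * (q * exp (- (3 / 2 * K)) * (K * A) * exp (- (pi * A) / (l * M)))"
  proof -
    \<comment> \<open>With \<open>y = K A / M\<close> the factor \<open>M exp (- y / 2)\<close> is to be compared with \<open>M y exp (- 2 y)\<close>.\<close>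
    define y where "y = K * A / M"
    have y: "0 \<le> y" "M * y = K * A" using K A0 M0 by (auto simp: y_def)
    have "y \<le> exp (3 / 2 * y)" using exp_ge_add_one_self[of "3 / 2 * y"] y(1) by linarith
    then have "(K * A) * exp (- (2 * y)) \<le> M * exp (3 / 2 * y) * exp (- (2 * y))"
      unfolding y(2)[symmetric] using M0 by (intro mult_right_mono mult_left_mono) auto
    also have "\<dots> = M * exp (- (y / 2))" by (simp add: mult.assoc exp_add[symmetric])
    finally have "(K * A) * exp (- (2 * y)) \<le> M * exp (- (y / 2))" .
    moreover have "- (2 * y) = - (pi * A) / (l * M)" by (simp add: y_def K_def)
    moreover have "exp (- K * R) = exp (- (3 / 2 * K)) * exp (- (y / 2))"
      by (simp add: R_def y_def exp_add[symmetric] algebra_simps)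
    ultimately have "q * exp (- (3 / 2 * K)) * (K * A * exp (- (pi * A) / (l * M))) \<le> q * exp (- (3 / 2 * K)) * (M * exp (- (y / 2)))"
      using q0 by (intro mult_left_mono) auto
    then show ?thesis
      using \<kappa>_pos \<open>exp (- K * R) = _\<close> by (simp add: mult.assoc mult.left_commute mult.commute)
  qed
  finally show ?thesis by (simp add: q_def F0_def M_def mult.assoc)
qed

end

section \<open>Decay of the maximal height\<close>

lemma classical_solution_flow:
  assumes l: "0 < l" and \<rho>: "0 < \<rho>2 - \<rho>1" and T: "0 < T" and nonneg: "\<And>x. 0 \<le> f0 x"
    and sol: "classical_solution l \<rho>1 \<rho>2 k T f0 f"
  obtains v where "muskat_flow T (\<lambda>t. Bcontfun (f t)) v l ((\<rho>2 - \<rho>1) / (8 * l))"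
    and "\<And>t. t \<in> {0..T} \<Longrightarrow> apply_bcontfun (Bcontfun (f t)) = f t"
proof -
  define u where "u = (\<lambda>t. Bcontfun (f t))"
  define \<kappa> where "\<kappa> = (\<rho>2 - \<rho>1) / (8 * l)"
  have \<kappa>: "0 < \<kappa>" using l \<rho> by (simp add: \<kappa>_def)
  have strip: "f t \<in> sobolev_space_strip l k" if "t \<in> {0..T}" for t
    using sol that by (auto simp: classical_solution_def cont_into_sobolev_strip_def)
  have bc: "f t \<in> bcontfun" if "t \<in> {0..T}" for t
    using sol that by (auto simp: classical_solution_def C1_into_C_def)
  have u: "apply_bcontfun (u t) = f t" if "t \<in> {0..T}" for t
    unfolding u_def using bc[OF that] by (rule Bcontfun_inverse)
  have cont: "continuous_on UNIV (f t)" if "t \<in> {0..T}" for t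
    using bc[OF that] by (simp add: bcontfun_def)
  obtain v :: "real \<Rightarrow> real \<Rightarrow>\<^sub>C real" where v: "\<And>t. t \<in> {0..T} \<Longrightarrow> (u has_vector_derivative v t) (at t within {0..T})"
    using sol unfolding classical_solution_def C1_into_C_def u_def by blast
  have diff: "(deriv ^^ j) (f t) differentiable (at x)" if "t \<in> {0..T}" "j < 2" for t j x
    using sol that by (auto simp: classical_solution_def cont_into_C2_def)
  have C2: "(deriv ^^ j) (f t) \<in> bcontfun" if "t \<in> {0..T}" "j \<le> 2" for t j
    using sol that by (auto simp: classical_solution_def cont_into_C2_def)
  have d1: "(f t has_real_derivative deriv (f t) x) (at x)" if "t \<in> {0..T}" for t x
    using diff[OF that, of 0 x] by (simp add: DERIV_deriv_iff_real_differentiable)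
  have d2: "(deriv (f t) has_real_derivative deriv (deriv (f t)) x) (at x)" if "t \<in> {0..T}" for t x
    using diff[OF that, of 1 x] by (simp add: DERIV_deriv_iff_real_differentiable)
  have b1: "\<exists>B. \<forall>x. \<bar>deriv (f t) x\<bar> \<le> B" if "t \<in> {0..T}" for t
    using C2[OF that, of 1] by (auto simp: bcontfun_def bounded_iff)
  have b2: "\<exists>B. \<forall>x. \<bar>deriv (deriv (f t)) x\<bar> \<le> B" if "t \<in> {0..T}" for t
    using C2[OF that, of 2] by (auto simp: bcontfun_def bounded_iff numeral_2_eq_2)
  have Lipschitz: "\<bar>g x - g y\<bar> \<le> B * \<bar>x - y\<bar>"
    if "\<And>x. (g has_real_derivative g' x) (at x)" "\<And>x. \<bar>g' x\<bar> \<le> B" for g g' :: "real \<Rightarrow> real" and B x y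
    using field_differentiable_bound[of UNIV g g' B x y] that by (auto intro: has_field_derivative_at_within)
  have decay: "(f t \<longlongrightarrow> 0) at_infinity" if t: "t \<in> {0..T}" for t
  proof -
    obtain B where B: "\<And>x. \<bar>deriv (f t) x\<bar> \<le> B" using b1[OF t] by blast
    show ?thesis
    proof (rule square_integrable_Lipschitz_tendsto_0)
      show "f t \<in> L2_space" using strip[OF t] by (simp add: sobolev_space_strip_def sobolev_space_def)
      show "0 \<le> B" using B[of 0] by linarith
      show "\<bar>f t x - f t y\<bar> \<le> B * \<bar>x - y\<bar>" for x y by (rule Lipschitz[OF d1[OF t] B])
    qed
  qed
  have amp: "\<exists>m<l. \<forall>y. \<bar>f t y\<bar> \<le> m" if t: "t \<in> {0..T}" for t
  proof -
    have "Linf_norm (f t) < ereal l" using strip[OF t] by (simp add: sobolev_space_strip_def)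
    then obtain m where m: "Linf_norm (f t) < ereal m" "ereal m < ereal l"
      using ereal_dense2 by blast
    have "\<bar>f t y\<bar> \<le> m" for y
    proof -
      have "ereal \<bar>f t y\<bar> \<le> Linf_norm (f t)"
        unfolding Linf_norm_eq_SUP[OF cont[OF t]] by (rule SUP_upper) simp
      then have "ereal \<bar>f t y\<bar> < ereal m" using m(1) by (rule le_less_trans)
      then show ?thesis by simp
    qed
    then show ?thesis using m(2) by auto
  qed
  interpret curve: decaying_curve T u v
    by standard (use T v decay u in auto)
  have law: "has_pv_integral (muskat_integrand l (f t) x) (v t x / \<kappa>)" if t: "t \<in> {0..T}" for t x
  proof -
    obtain I where I: "has_pv_integral (muskat_integrand l (f t) x) I"
      "((\<lambda>s. f s x) has_real_derivative \<kappa> * I) (at t within {0..T})"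
      using sol t unfolding classical_solution_def muskat_equation_def \<kappa>_def by blast
    have "((\<lambda>s. f s x) has_real_derivative v t x) (at t within {0..T})"
      by (rule has_field_derivative_transform_within[OF curve.pointwise_velocity[OF t] zero_less_one t]) (simp add: u)
    with I(2) have "\<kappa> * I = v t x"
      unfolding has_real_derivative_iff_has_vector_derivative
      using vector_derivative_unique_within_closed_interval[OF T, of t] t by simp
    then have "I = v t x / \<kappa>" using \<kappa> by (simp add: field_simps)
    with I(1) show ?thesis by simp
  qed
  have prof: "strip_profile l (f t)" if t: "t \<in> {0..T}" for t
  proof
    show "\<bar>f t y\<bar> < l" for y using amp[OF t] by (meson le_less_trans)
    show "continuous_on UNIV (deriv (f t))"
      using d2[OF t] DERIV_isCont continuous_at_imp_continuous_on by blast
  qed (use l d1[OF t] decay[OF t] in auto)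
  have "muskat_flow T u v l \<kappa>"
  proof (rule muskat_flow.intro[OF curve.decaying_curve_axioms muskat_flow_axioms.intro])
    fix t assume t: "t \<in> {0..T}"
    show "strip_profile l (u t)" unfolding u[OF t] by (rule prof[OF t])
    show "\<exists>m<l. \<forall>y. \<bar>u t y\<bar> \<le> m" unfolding u[OF t] by (rule amp[OF t])
    show "\<exists>B. \<forall>y. \<bar>deriv (u t) y\<bar> \<le> B" unfolding u[OF t] by (rule b1[OF t])
    show "\<exists>B. \<forall>y z. \<bar>deriv (u t) y - deriv (u t) z\<bar> \<le> B * \<bar>y - z\<bar>"
      unfolding u[OF t] using b2[OF t] Lipschitz[OF d2[OF t]] by blast
    show "has_pv_integral (muskat_integrand l (u t) x) (v t x / \<kappa>)" for x
      unfolding u[OF t] by (rule law[OF t])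
  next
    fix x
    have "f 0 = f0" using sol by (simp add: classical_solution_def)
    then show "0 \<le> u 0 x" using u[of 0] T nonneg by simp
  qed (rule \<kappa>)
  then show thesis using that u unfolding u_def \<kappa>_def by blast
qed

text \<open>The constant of \<open>crest_sinks\<close>, where \<open>M\<close> is the initial height.\<close>

definition decay_rate :: "real \<Rightarrow> real \<Rightarrow> real \<Rightarrow> real \<Rightarrow> real \<Rightarrow> real" where
  "decay_rate A M \<rho>2 \<rho>1 l = (\<rho>2 - \<rho>1) / (8 * l) *
     ((cos (pi / (2 * l) * M))\<^sup>2 * (1 - sin (pi / (2 * l) * M)) / 8 * (pi / (2 * l))) *
     exp (- (3 / 2 * (pi / (2 * l)))) * (pi / (2 * l) * A)"

theorem theorem6:
  shows "\<exists>c :: real \<Rightarrow> real \<Rightarrow> real \<Rightarrow> real \<Rightarrow> real \<Rightarrow> real.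
    (\<forall>A M \<rho>2 \<rho>1 l. 0 < c A M \<rho>2 \<rho>1 l) \<and>
    (\<forall>(l::real) (\<rho>1::real) (\<rho>2::real) (k::nat) (T::real)
      (f0 :: real \<Rightarrow> real) (f :: real \<Rightarrow> real \<Rightarrow> real).
      0 < l \<longrightarrow> 0 < \<rho>2 - \<rho>1 \<longrightarrow> 3 \<le> k \<longrightarrow> 0 < T \<longrightarrow>
      integrable lborel f0 \<longrightarrow> f0 \<in> sobolev_space_strip l k \<longrightarrow>
      (\<forall>x. 0 \<le> f0 x) \<longrightarrow> (\<exists>x. f0 x \<noteq> 0) \<longrightarrow>
      classical_solution l \<rho>1 \<rho>2 k T f0 f \<longrightarrow>
      (AE t in lborel. t \<in> {0..T} \<longrightarrow>
        (\<exists>D. ((\<lambda>s. real_of_ereal (Linf_norm (f s))) has_real_derivative D)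
                (at t within {0..T}) \<and>
             D \<le> - c (L1_norm f0) (real_of_ereal (Linf_norm f0)) \<rho>2 \<rho>1 l *
                  exp (- (pi * L1_norm f0) / (l * real_of_ereal (Linf_norm (f t)))))))"
proof -
  \<comment> \<open>The rate is positive for all data of a nonzero solution; the value 1 makes \<open>c\<close> positive for arbitrary arguments.\<close>
  define c where "c = (\<lambda>A M \<rho>2 \<rho>1 l. if 0 < decay_rate A M \<rho>2 \<rho>1 l then decay_rate A M \<rho>2 \<rho>1 l else 1)"
  have c_pos: "\<forall>A M \<rho>2 \<rho>1 l. 0 < c A M \<rho>2 \<rho>1 l" by (simp add: c_def)
  have main: "AE t in lborel. t \<in> {0..T} \<longrightarrow>
        (\<exists>D. ((\<lambda>s. real_of_ereal (Linf_norm (f s))) has_real_derivative D)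
                (at t within {0..T}) \<and>
             D \<le> - c (L1_norm f0) (real_of_ereal (Linf_norm f0)) \<rho>2 \<rho>1 l *
                  exp (- (pi * L1_norm f0) / (l * real_of_ereal (Linf_norm (f t)))))"
    if l: "0 < l" and \<rho>: "0 < \<rho>2 - \<rho>1" and T: "0 < T" and int: "integrable lborel f0"
      and nonneg: "\<And>x. 0 \<le> f0 x" and nonzero: "f0 x0 \<noteq> 0"
      and sol: "classical_solution l \<rho>1 \<rho>2 k T f0 f"
    for l \<rho>1 \<rho>2 :: real and k :: nat and T :: real and f0 :: "real \<Rightarrow> real" and f :: "real \<Rightarrow> real \<Rightarrow> real" and x0 :: real
  proof -
    obtain v where flow: "muskat_flow T (\<lambda>t. Bcontfun (f t)) v l ((\<rho>2 - \<rho>1) / (8 * l))"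
      and u: "\<And>t. t \<in> {0..T} \<Longrightarrow> apply_bcontfun (Bcontfun (f t)) = f t"
      using classical_solution_flow[OF l \<rho> T nonneg sol] by blast
    interpret muskat_flow T "\<lambda>t. Bcontfun (f t)" v l "(\<rho>2 - \<rho>1) / (8 * l)" by (rule flow)
    have f0: "f 0 = f0" using sol by (simp add: classical_solution_def)
    have zero: "0 \<in> {0..T}" using T by simp
    have u0: "apply_bcontfun (Bcontfun (f 0)) = f0" using u[OF zero] f0 by simp
    define A where "A = L1_norm f0"
    have A: "A = integral\<^sup>L lborel f0" using nonneg by (simp add: A_def L1_norm_def)
    have A_ge: "integral {a..b} (apply_bcontfun (Bcontfun (f 0))) \<le> A" for a b
    proof -
      have "(f0 has_integral A) UNIV" unfolding A by (rule has_integral_integral_lborel[OF int])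
      moreover have "f0 integrable_on {a..b}" using integrable_on_interval[of 0 a b] by (simp add: u0)
      ultimately have "integral {a..b} f0 \<le> integral UNIV f0"
        using nonneg by (intro integral_subset_le) auto
      also have "\<dots> = A" using \<open>(f0 has_integral A) UNIV\<close> by (rule integral_unique)
      finally show ?thesis by (simp add: u0)
    qed
    have high: "0 < top_value t" if "t \<in> {0..T}" for t
      using never_flat[of x0 t] nonzero that by (simp add: u0)
    have norm: "real_of_ereal (Linf_norm (f t)) = top_value t" if t: "t \<in> {0..T}" for t
    proof -
      obtain x where x: "x \<in> crest t" using crest_nonempty[OF t high[OF t]] by blast
      have "Linf_norm (f t) = ereal (top_value t)"
      proof (rule Linf_norm_attained)
        show "continuous_on UNIV (f t)" using continuous_on_apply_bcontfun[of UNIV "Bcontfun (f t)"] by (simp add: u[OF t])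
        show "\<bar>f t y\<bar> \<le> top_value t" for y
          using stays_nonneg[OF t, of y] le_top_value[of t y] by (simp add: u[OF t])
        show "\<bar>f t x\<bar> = top_value t"
          using stays_nonneg[OF t, of x] top_value_crest[OF x] by (simp add: u[OF t])
      qed
      then show ?thesis by simp
    qed
    have rate: "v t x \<le> - c A (top_value 0) \<rho>2 \<rho>1 l * exp (- (pi * A) / (l * top_value t))"
      if t: "t \<in> {0..T}" and x: "x \<in> crest t" for t x
    proof -
      have "0 < decay_rate A (top_value 0) \<rho>2 \<rho>1 l"
      proof -
        define F where "F = pi / (2 * l) * top_value 0"
        have F: "0 \<le> F" "F < pi / 2"
          using high[OF zero] initial_height_less l by (auto simp: F_def field_simps)
        have "sin F < sin (pi / 2)" using F by (intro sin_monotone_2pi) auto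
        then have "0 < 1 - sin F" by simp
        moreover have "0 < cos F" using F by (intro cos_gt_zero_pi) auto
        moreover have "0 < A"
        proof -
          have "0 < integral {x0 - 1..x0 + 1} f0"
            using nonneg nonzero continuous_on_apply_bcontfun[of UNIV "Bcontfun (f 0)"]
            by (intro integral_pos_around) (simp_all add: u0)
          also have "\<dots> \<le> A" using A_ge[of "x0 - 1" "x0 + 1"] by (simp add: u0)
          finally show ?thesis .
        qed
        ultimately show ?thesis
          using l \<rho> unfolding decay_rate_def F_def[symmetric]
          by (intro mult_pos_pos divide_pos_pos zero_less_power) auto
      qed
      then have c: "c A (top_value 0) \<rho>2 \<rho>1 l = decay_rate A (top_value 0) \<rho>2 \<rho>1 l" by (simp add: c_def)
      show ?thesis
        unfolding c decay_rate_def by (rule crest_sinks[OF A_ge t x high[OF t]])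
    qed
    have "countable {t \<in> {0..T}. \<exists>x\<in>crest t. \<exists>y\<in>crest t. v t x < v t y}"
      by (rule countable_crest_branching)
    then have "AE t in lborel. t \<notin> {t \<in> {0..T}. \<exists>x\<in>crest t. \<exists>y\<in>crest t. v t x < v t y}"
      by (intro AE_not_in countable_imp_null_set_lborel)
    then show ?thesis
    proof eventually_elim
      case (elim t)
      show ?case
      proof
        assume t: "t \<in> {0..T}"
        obtain x where x: "x \<in> crest t" using crest_nonempty[OF t high[OF t]] by blast
        have same: "v t y = v t x" if "y \<in> crest t" for y
          using elim t x that by (metis (mono_tags, lifting) linorder_neqE_linordered_idom mem_Collect_eq)
        have "(top_value has_real_derivative v t x) (at t within {0..T})"
          by (rule top_value_has_derivative[OF t high[OF t] same])
        then have "((\<lambda>s. real_of_ereal (Linf_norm (f s))) has_real_derivative v t x) (at t within {0..T})"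
          by (rule has_field_derivative_transform_within[OF _ zero_less_one t]) (simp add: norm)
        moreover have "v t x \<le> - c (L1_norm f0) (real_of_ereal (Linf_norm f0)) \<rho>2 \<rho>1 l *
                  exp (- (pi * L1_norm f0) / (l * real_of_ereal (Linf_norm (f t))))"
          using rate[OF t x] norm[OF t] norm[OF zero] by (simp add: A_def f0)
        ultimately show "\<exists>D. ((\<lambda>s. real_of_ereal (Linf_norm (f s))) has_real_derivative D)
                (at t within {0..T}) \<and>
             D \<le> - c (L1_norm f0) (real_of_ereal (Linf_norm f0)) \<rho>2 \<rho>1 l *
                  exp (- (pi * L1_norm f0) / (l * real_of_ereal (Linf_norm (f t))))" by blast
      qed
    qed
  qed
  show ?thesis
    using c_pos main by (intro exI[of _ c] conjI) blast+
qed

end
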